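(* Let $m\ge 0$ be an integer, let $0<\alpha<2$, let $f$ be a measurable function on $\mathbf{R}$ satisfying $$\int_{\mathbf{R}}\frac{|f(\xi)|}{1+|\xi|^{2+m}}\,d\xi<\infty ,$$ and let $\mu$ be a positive Borel measure on the upper half plane $\mathbf{C}_+$ satisfying $$\int_{\mathbf{C}_+}\frac{\eta}{1+|\zeta|^{2+m}}\,d\mu(\zeta)<\infty\qquad(\zeta=\xi+i\eta).$$ Define the subharmonic function $u(z)=v(z)+h(z)$, $z\in\mathbf{C}_+$, where $$v(z)=\int_{\mathbf{R}}P_m(z,\xi)f(\xi)\,d\xi,\qquad h(z)=\int_{\mathbf{C}_+}G_m(z,\zeta)\,d\mu(\zeta),$$ with $P_m$ the modified Poisson kernel and $G_m$ the modified Green function. Then there exist a (finite or infinite) sequence of points $z_j\in\mathbf{C}_+$ and numbers $\rho_j>0$ such that $$\sum_{j}\frac{\rho_j^{2-\alpha}}{|z_j|^{2-\alpha}}<\infty$$ and such that, with $G=\bigcup_{j}B(z_j,\rho_j)$, $$u(z)=o\left(y^{1-\alpha}|z|^{m+\alpha}\right)\quad\text{as } |z|\to\infty,\ z=x+iy\in\mathbf{C}_+\setminus G .$$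
   Context: $\mathbf{C}_+=\{z=x+iy\in\mathbf{C}: y>0\}$, and $B(z,\rho)$ is the open ball (disc) of radius $\rho$ centered at $z$ in $\mathbf{C}$. Modified Poisson kernel: with $P(z,\xi)=\dfrac{y}{\pi|z-\xi|^2}$ for $z=x+iy\in\mathbf{C}_+$, $\xi\in\mathbf{R}$, $$P_m(z,\xi)=\begin{cases}P(z,\xi), & |\xi|\le 1,\\[2pt] P(z,\xi)-\dfrac1\pi\,\Im\displaystyle\sum_{k=0}^{m}\frac{z^k}{\xi^{1+k}}, & |\xi|>1.\end{cases}$$ Modified Green function: let $E(z)=(2\pi)^{-1}\log|z|$ for $z\in\mathbf{C}\setminus\{0\}$. For an integer $n\ge 1$ define (as a function of the pair $(z,\zeta)$, $z\neq\zeta$) $$E_n(z-\zeta)=\begin{cases}E(z-\zeta), & |\zeta|\le 1,\\[2pt] E(z-\zeta)-\dfrac{1}{2\pi}\,\Re\left(\log\zeta-\displaystyle\sum_{k=1}^{n-1}\frac{z^k}{k\zeta^k}\right), & |\zeta|>1,\end{cases}$$ where $\Re\log\zeta=\log|\zeta|$, and set $$G_m(z,\zeta)=E_{m+1}(z-\zeta)-E_{m+1}(z-\overline{\zeta}),\qquad z,\zeta\in\overline{\mathbf{C}_+},\ z\ne\zeta,$$ where $E_{m+1}(z-\overline\zeta)$ is the function $E_n$ with $n=m+1$ evaluated at the pair $(z,\overline\zeta)$, that is, $E_{m+1}(z-\overline\zeta)=E(z-\overline\zeta)$ if $|\zeta|\le 1$ and $E_{m+1}(z-\overline\zeta)=E(z-\overline\zeta)-\dfrac{1}{2\pi}\,\Re\left(\log\overline\zeta-\displaystyle\sum_{k=1}^{m}\frac{z^k}{k\overline\zeta^{\,k}}\right)$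 if $|\zeta|>1$. On the diagonal, $G_m(z,z)=-\infty$ for $z\in\mathbf{C}_+$, so $h$ and $u$ may take the value $-\infty$. The statement $u(z)=o(y^{1-\alpha}|z|^{m+\alpha})$ means: for every $\varepsilon>0$ there is $R>0$ such that $|u(z)|\le\varepsilon y^{1-\alpha}|z|^{m+\alpha}$ for all $z\in\mathbf{C}_+\setminus G$ with $|z|\ge R$. *)

theory Defs
  imports "HOL-Analysis.Analysis"
begin

abbreviation upper_half_plane :: "complex set" ("\<complex>\<^sub>+") where
  "\<complex>\<^sub>+ \<equiv> {z. Im z > 0}"

definition poisson_kernel :: "complex \<Rightarrow> real \<Rightarrow> real" where
  "poisson_kernel z \<xi> = Im z / (pi * (cmod (z - of_real \<xi>))\<^sup>2)"

definition mod_poisson_kernel :: "nat \<Rightarrow> complex \<Rightarrow> real \<Rightarrow> real" where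
  "mod_poisson_kernel m z \<xi> =
     (if \<bar>\<xi>\<bar> \<le> 1 then poisson_kernel z \<xi>
      else poisson_kernel z \<xi> - 1 / pi * Im (\<Sum>k=0..m. z ^ k / of_real \<xi> ^ (1 + k)))"

(* Meant for z \<noteq> 0: the value at 0 is junk, and mod_green below never evaluates it there
   for z in the upper half plane and w in its closure. *)
definition log_kernel :: "complex \<Rightarrow> real" where
  "log_kernel z = 1 / (2 * pi) * ln (cmod z)"

(* Written E_n(z - w) in the literature, but it is a function of the pair (z, w), not of the
   difference. The index n is meant to be at least 1. *)
definition mod_log_kernel :: "nat \<Rightarrow> complex \<Rightarrow> complex \<Rightarrow> real" where
  "mod_log_kernel n z w =
     (if cmod w \<le> 1 then log_kernel (z - w)
      else log_kernel (z - w)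
             - 1 / (2 * pi) * Re (Ln w - (\<Sum>k=1..<n. z ^ k / (of_nat k * w ^ k))))"

definition mod_green :: "nat \<Rightarrow> complex \<Rightarrow> complex \<Rightarrow> ereal" where
  "mod_green m z w =
     (if z = w then - \<infinity>
      else ereal (mod_log_kernel (m + 1) z w - mod_log_kernel (m + 1) z (cnj w)))"

(* The Lebesgue integral of an extended-real function, as the integral of the positive part
   minus that of the negative part (e2ennreal maps negative numbers to 0). It is meaningful
   when at least one of the two is finite. For mod_green m z with z in the upper half plane,
   the positive part has finite integral under the hypothesis on the measure made in the
   theorem, so the potential below takes values in [-\<infinity>, \<infinity>). *)
definition ereal_integral :: "'a measure \<Rightarrow> ('a \<Rightarrow> ereal) \<Rightarrow> ereal" where
  "ereal_integral M g =
     enn2ereal (\<integral>\<^sup>+x. e2ennreal (g x) \<partial>M) - enn2ereal (\<integral>\<^sup>+x. e2ennreal (- g x) \<partial>M)"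

definition mod_poisson_integral :: "nat \<Rightarrow> (real \<Rightarrow> real) \<Rightarrow> complex \<Rightarrow> real" where
  "mod_poisson_integral m f z = (\<integral>\<xi>. mod_poisson_kernel m z \<xi> * f \<xi> \<partial>lebesgue)"

definition mod_green_potential :: "nat \<Rightarrow> complex measure \<Rightarrow> complex \<Rightarrow> ereal" where
  "mod_green_potential m \<mu> z = ereal_integral \<mu> (mod_green m z)"

end

theory Submission
  imports Defs
begin

text \<open>
  Turn the hypotheses into finite measures \<nu> on the plane with densities
  |f(\<xi>)| / (1 + |\<xi>|^(2+m)) and \<eta> / (1 + |\<zeta>|^(2+m)). Subtracting Taylor polynomials
  makes both kernels, divided by these weights, at most a constant times y |z|^m min(1, (1+|\<zeta>|)/|z|),
  except on the disc |\<zeta> - z| < |z|/2, where a multiple of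
  |z|^(m+2) y^(-1) min(t^2, t^\<delta>) with t = y/|z-\<zeta>| has to be added. The first term is
  o(y |z|^m) by dominated convergence. For the second one, take 0 < \<delta> < \<beta> = 2 - \<alpha>:
  if \<nu>(B(z,\<rho>)) \<le> \<epsilon> (\<rho>/|z|)^\<beta> for all \<rho> \<le> |z|/2, then a
  dyadic decomposition gives at most a constant times \<epsilon> |z|^(m+2) y^(-1) (y/|z|)^\<beta>, which is
  \<epsilon> y^(1-\<alpha>) |z|^(m+\<alpha>). The points violating the condition are covered, annulus by annulus,
  using Vitali's lemma, and \<epsilon> may tend to 0 so slowly along the annuli that the
  covering discs still satisfy the summability condition.
\<close>

section \<open>The exceptional discs\<close>

text \<open>The exponent \<beta> must lie strictly between \<delta> and 2: scales below y form a
  geometric series of ratio \<open>2 powr (\<delta> - \<beta>)\<close>, scales above y one of ratio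
  \<open>2 powr (\<beta> - 2)\<close>. The exponent \<delta> exists for the sake of the Green
  function, whose logarithmic pole is swallowed by any positive power of t; for the Poisson kernel t
  \<le> 1, and t^2 is the smaller of the two. Moving each weight into a measure on the plane lets
  one covering argument serve the boundary integral and the potential alike; the two families of
  discs are merged only at the end. Convergence is not settled beforehand. The kernels are bounded
  pointwise, in absolute value, by a function with values in [0, \<infinity>] that is infinite on
  the diagonal, so one upper bound for its integral controls a Bochner integral as well as a
  potential that could be -\<infinity>.\<close>

lemma summable_divide_vanishing:
  fixes a :: "nat \<Rightarrow> real"
  assumes nonneg: "\<And>i. a i \<ge> 0" and "summable a"
  obtains e where "\<And>i. e i > 0" "e \<longlonglongrightarrow> 0" "summable (\<lambda>i. a i / e i)"
proof -
  \<comment> \<open>The geometric summand keeps all tails \<open>T i\<close> positive, so that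
    dividing by their roots is safe even if \<open>a\<close> vanishes from some index on.\<close>
  define b where "b k = a k + (1/2) ^ k" for k
  define T where "T i = (\<Sum>k. b (k + i))" for i
  have sb: "summable b"
    unfolding b_def by (intro summable_add assms summable_geometric) simp
  have b0: "b k > 0" for k
    unfolding b_def using nonneg[of k] by (simp add: add_nonneg_pos)
  have Tpos: "T i > 0" for i
    unfolding T_def using sb b0 by (intro suminf_pos) (simp_all add: summable_iff_shift)
  have Tdiff: "T i = b i + T (Suc i)" for i
    unfolding T_def using suminf_split_head[of "\<lambda>k. b (k + i)"] sb by (simp add: summable_iff_shift)
  have T0: "T \<longlonglongrightarrow> 0"
    unfolding T_def by (rule suminf_exist_split2[OF sb])
  have e0: "(\<lambda>i. sqrt (T i)) \<longlonglongrightarrow> 0"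
    using tendsto_real_sqrt[OF T0] by simp
  \<comment> \<open>Dini's device: a i \<le> T i - T (i + 1) is written as a difference of squares
    of roots, and division by \<open>sqrt (T i)\<close> leaves a telescoping series.\<close>
  have bound: "a i / sqrt (T i) \<le> 2 * (sqrt (T i) - sqrt (T (Suc i)))" for i
  proof -
    have le: "sqrt (T (Suc i)) \<le> sqrt (T i)"
      using Tdiff[of i] b0[of i] by simp
    have "a i \<le> T i - T (Suc i)"
      using Tdiff[of i] unfolding b_def by simp
    also have "\<dots> = (sqrt (T i) - sqrt (T (Suc i))) * (sqrt (T i) + sqrt (T (Suc i)))"
      using Tpos[of i] Tpos[of "Suc i"] by (simp add: algebra_simps)
    also have "\<dots> \<le> (sqrt (T i) - sqrt (T (Suc i))) * (2 * sqrt (T i))"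
      using le by (intro mult_left_mono) simp_all
    finally show ?thesis
      using Tpos[of i] by (simp add: field_simps)
  qed
  have "summable (\<lambda>i. 2 * (sqrt (T i) - sqrt (T (Suc i))))"
    by (intro summable_mult telescope_summable'[OF e0])
  then have "summable (\<lambda>i. a i / sqrt (T i))"
    by (rule summable_comparison_test'[of _ 0])
      (use bound nonneg Tpos in \<open>simp add: less_imp_le\<close>)
  then show ?thesis
    using that[of "\<lambda>i. sqrt (T i)"] Tpos e0 by simp
qed

text \<open>Each window is the union of three consecutive disjoint octaves. Three are taken because
  a ball centred in the middle octave, of radius at most half the modulus of its centre, stays
  inside the window.\<close>

lemma finite_measure_annuli_summable:
  assumes "finite_measure N" "sets N = sets (borel :: complex measure)"
  shows "summable (\<lambda>i. measure N {z. 2 ^ i \<le> cmod z \<and> cmod z < 2 ^ (i + 3)})"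
proof -
  interpret finite_measure N by fact
  define D where "D i = {z. 2 ^ i \<le> cmod z \<and> cmod z < 2 ^ Suc i}" for i :: nat
  have D: "D i \<in> sets N" for i
    unfolding D_def assms(2) by measurable
  have disj: "disjoint_family D"
  proof -
    have "D i \<inter> D j = {}" if "i < j" for i j
    proof -
      have "(2::real) ^ Suc i \<le> 2 ^ j"
        using that by (intro power_increasing) auto
      then show ?thesis
        unfolding D_def by auto
    qed
    then show ?thesis
      unfolding disjoint_family_on_def by (metis inf_commute linorder_neqE_nat)
  qed
  have "(\<lambda>i. measure N (D i)) sums measure N (\<Union>i. D i)"
    using D disj by (intro finite_measure_UNION) auto
  then have s: "summable (\<lambda>i. measure N (D i))"
    by (rule sums_summable)
  have "summable (\<lambda>i. measure N (D i) + measure N (D (i + 1)) + measure N (D (i + 2)))"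
    using s by (intro summable_add summable_ignore_initial_segment)
  then show ?thesis
  proof (rule summable_comparison_test'[of _ 0])
    fix i :: nat
    have "{z. 2 ^ i \<le> cmod z \<and> cmod z < 2 ^ (i + 3)} \<subseteq> D i \<union> D (i + 1) \<union> D (i + 2)"
      unfolding D_def by (auto simp: power_add)
    then have "measure N {z. 2 ^ i \<le> cmod z \<and> cmod z < 2 ^ (i + 3)} \<le> measure N (D i \<union> D (i + 1) \<union> D (i + 2))"
      using D by (intro finite_measure_mono) auto
    also have "\<dots> \<le> measure N (D i) + measure N (D (i + 1)) + measure N (D (i + 2))"
      using measure_Un_le[of "D i \<union> D (i + 1)" N "D (i + 2)"]
        measure_Un_le[of "D i" N "D (i + 1)"] D by fastforce
    finally show "norm (measure N {z. 2 ^ i \<le> cmod z \<and> cmod z < 2 ^ (i + 3)})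
        \<le> measure N (D i) + measure N (D (i + 1)) + measure N (D (i + 2))"
      by simp
  qed
qed

text \<open>Discs are pairs (centre, radius) collected in a set, which makes unions of families
  immediate; the sequence demanded by the theorem is chosen only at the end.\<close>

definition admissible_discs :: "real \<Rightarrow> (complex \<times> real) set \<Rightarrow> bool" where
  "admissible_discs \<beta> S \<longleftrightarrow> countable S \<and> (\<forall>p\<in>S. Im (fst p) > 0 \<and> snd p > 0) \<and>
     (\<lambda>(c, r). (r / cmod c) powr \<beta>) summable_on S"

text \<open>With a filter, asymptotic bounds combine freely, and passing to more discs is just an
  inequality of filters.\<close>

definition far_outside :: "(complex \<times> real) set \<Rightarrow> complex filter" where
  "far_outside S = inf at_infinity (principal {z. Im z > 0 \<and> z \<notin> (\<Union>(c, r)\<in>S. ball c r)})"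

lemma eventually_far_outside:
  "eventually P (far_outside S) \<longleftrightarrow>
     (\<exists>R. \<forall>z. Im z > 0 \<longrightarrow> cmod z \<ge> R \<longrightarrow> z \<notin> (\<Union>(c, r)\<in>S. ball c r) \<longrightarrow> P z)"
  unfolding far_outside_def eventually_inf_principal eventually_at_infinity
  by (simp only: mem_Collect_eq imp_conjL) metis

lemma far_outside_antimono: "S \<subseteq> T \<Longrightarrow> far_outside T \<le> far_outside S"
  unfolding far_outside_def by (rule inf_mono[OF order_refl]) (auto simp: principal_le_iff)

lemma eventually_far_outside_basic:
  "\<forall>\<^sub>F z in far_outside S. Im z > 0 \<and> cmod z \<ge> R"
  unfolding eventually_far_outside by (intro exI[of _ R]) simp

lemma admissible_discs_Un:
  assumes "admissible_discs \<beta> S" "admissible_discs \<beta> T"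
  shows "admissible_discs \<beta> (S \<union> T)"
proof -
  have "(\<lambda>(c, r). (r / cmod c) powr \<beta>) summable_on S \<union> (T - S)"
    using assms unfolding admissible_discs_def
    by (intro summable_on_Un_disjoint summable_on_subset_banach[of _ T "T - S"]) blast+
  then have "(\<lambda>(c, r). (r / cmod c) powr \<beta>) summable_on S \<union> T"
    by (simp only: Un_Diff_cancel)
  moreover have "\<forall>p\<in>S \<union> T. Im (fst p) > 0 \<and> snd p > 0"
    using assms unfolding admissible_discs_def by blast
  moreover have "countable (S \<union> T)"
    using assms by (simp add: admissible_discs_def)
  ultimately show ?thesis
    unfolding admissible_discs_def by (intro conjI)
qed

text \<open>A violating ball pays for itself: (\<rho>/|z|)^\<beta> is less than its mass divided by
  e. The selected balls are disjoint, so their masses add up to at most that of the window, and the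
  fivefold enlargement that restores the covering costs \<open>5 powr \<beta>\<close>. Finite
  subfamilies are what unordered summation asks for later.\<close>

lemma annulus_exceptional_discs:
  fixes N :: "complex measure"
  assumes "finite_measure N" "sets N = sets borel" and "\<beta> > 0" "e > 0"
  obtains S :: "(complex \<times> real) set"
  where "countable S"
    "\<And>c r. (c, r) \<in> S \<Longrightarrow> Im c > 0 \<and> r > 0 \<and> 2 ^ (i + 1) \<le> cmod c \<and> cmod c < 2 ^ (i + 2)"
    "\<And>F. finite F \<Longrightarrow> F \<subseteq> S \<Longrightarrow> (\<Sum>(c, r)\<in>F. (r / cmod c) powr \<beta>)
        \<le> 5 powr \<beta> * (measure N {z. 2 ^ i \<le> cmod z \<and> cmod z < 2 ^ (i + 3)} / e)"
    "\<And>z \<rho>. Im z > 0 \<Longrightarrow> 2 ^ (i + 1) \<le> cmod z \<Longrightarrow> cmod z < 2 ^ (i + 2) \<Longrightarrow>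
        z \<notin> (\<Union>(c, r)\<in>S. ball c r) \<Longrightarrow> 0 < \<rho> \<Longrightarrow> \<rho> \<le> cmod z / 2 \<Longrightarrow>
        measure N (ball z \<rho>) \<le> e * (\<rho> / cmod z) powr \<beta>"
proof -
  interpret finite_measure N by fact
  let ?W = "{z. 2 ^ i \<le> cmod z \<and> cmod z < 2 ^ (i + 3)}"
  define K where "K = {(z, \<rho>). Im z > 0 \<and> 2 ^ (i + 1) \<le> cmod z \<and> cmod z < 2 ^ (i + 2) \<and> 0 < \<rho> \<and>
     \<rho> \<le> cmod z / 2 \<and> measure N (ball z \<rho>) > e * (\<rho> / cmod z) powr \<beta>}"
  \<comment> \<open>The set to be covered is the union of the violating balls itself; the other
    premise of the covering lemma is a uniform bound on the radii.\<close>
  have "(\<Union>p\<in>K. ball (fst p) (snd p)) \<subseteq> (\<Union>p\<in>K. ball (fst p) (snd p))" ..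
  moreover have "0 < snd p \<and> snd p \<le> 2 ^ (i + 2) / 2" if "p \<in> K" for p
    using that unfolding K_def by auto
  ultimately obtain C where C: "countable C" "C \<subseteq> K"
    "pairwise (\<lambda>p q. disjnt (ball (fst p) (snd p)) (ball (fst q) (snd q))) C"
    "(\<Union>p\<in>K. ball (fst p) (snd p)) \<subseteq> (\<Union>p\<in>C. ball (fst p) (5 * snd p))"
    by (rule Vitali_covering_lemma_balls)
  let ?g = "\<lambda>(c, r). (c, 5 * r) :: complex \<times> real"
  have inj: "inj ?g"
    by (auto simp: inj_on_def)
  show ?thesis
  proof
    show "countable (?g ` C)"
      using C by simp
  next
    fix c r assume "(c, r) \<in> ?g ` C"
    then show "Im c > 0 \<and> r > 0 \<and> 2 ^ (i + 1) \<le> cmod c \<and> cmod c < 2 ^ (i + 2)"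
      using C(2) unfolding K_def by auto
  next
    fix F assume F: "finite F" "F \<subseteq> ?g ` C"
    obtain F' where F': "finite F'" "F' \<subseteq> C" "F = ?g ` F'"
      using F finite_subset_image by metis
    have meas: "ball (fst p) (snd p) \<in> sets N" for p :: "complex \<times> real"
      using assms(2) by simp
    have sub: "ball (fst p) (snd p) \<subseteq> ?W" if "p \<in> F'" for p
    proof
      fix w assume w: "w \<in> ball (fst p) (snd p)"
      have p: "2 ^ (i + 1) \<le> cmod (fst p)" "cmod (fst p) < 2 ^ (i + 2)" "snd p \<le> cmod (fst p) / 2"
        using that F' C(2) unfolding K_def by auto
      have "cmod (fst p - w) < cmod (fst p) / 2"
        using w p by (simp add: dist_norm)
      then have "cmod w > cmod (fst p) / 2" "cmod w < 2 * cmod (fst p)"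
        using norm_triangle_ineq2[of "fst p" w] norm_triangle_ineq2[of w "fst p"]
        by (auto simp: norm_minus_commute)
      then show "w \<in> ?W"
        using p by (auto simp: power_add)
    qed
    have "(\<Sum>(c, r)\<in>F. (r / cmod c) powr \<beta>) = (\<Sum>p\<in>F'. (5 * snd p / cmod (fst p)) powr \<beta>)"
      unfolding F'(3) using inj by (subst sum.reindex) (auto simp: inj_on_def case_prod_unfold)
    also have "\<dots> \<le> (\<Sum>p\<in>F'. 5 powr \<beta> * (measure N (ball (fst p) (snd p)) / e))"
    proof (rule sum_mono)
      fix p assume "p \<in> F'"
      then have p: "0 < snd p" "measure N (ball (fst p) (snd p)) > e * (snd p / cmod (fst p)) powr \<beta>"
        using F' C(2) unfolding K_def by auto
      have "(5 * snd p / cmod (fst p)) powr \<beta> = 5 powr \<beta> * (snd p / cmod (fst p)) powr \<beta>"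
        using p(1) powr_mult[of 5 "snd p / cmod (fst p)" \<beta>] by simp
      also have "(snd p / cmod (fst p)) powr \<beta> \<le> measure N (ball (fst p) (snd p)) / e"
        using p(2) \<open>e > 0\<close> by (simp add: field_simps)
      finally show "(5 * snd p / cmod (fst p)) powr \<beta> \<le> 5 powr \<beta> * (measure N (ball (fst p) (snd p)) / e)"
        by simp
    qed
    also have "\<dots> = 5 powr \<beta> * ((\<Sum>p\<in>F'. measure N (ball (fst p) (snd p))) / e)"
      by (simp add: sum_distrib_left sum_divide_distrib)
    also have "(\<Sum>p\<in>F'. measure N (ball (fst p) (snd p))) = measure N (\<Union>p\<in>F'. ball (fst p) (snd p))"
    proof (rule finite_measure_finite_Union[symmetric])
      show "disjoint_family_on (\<lambda>p. ball (fst p) (snd p)) F'"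
        using pairwise_subset[OF C(3) F'(2)] unfolding disjoint_family_on_def pairwise_def disjnt_def .
    qed (use F' meas in auto)
    also have "\<dots> \<le> measure N ?W"
    proof (rule finite_measure_mono)
      show "?W \<in> sets N"
        unfolding assms(2) by measurable
    qed (use sub in blast)
    finally show "(\<Sum>(c, r)\<in>F. (r / cmod c) powr \<beta>) \<le> 5 powr \<beta> * (measure N ?W / e)"
      using \<open>e > 0\<close> by (simp add: divide_right_mono)
  next
    fix z \<rho> assume z: "Im z > 0" "2 ^ (i + 1) \<le> cmod z" "cmod z < 2 ^ (i + 2)"
      "z \<notin> (\<Union>(c, r)\<in>?g ` C. ball c r)" and \<rho>: "0 < \<rho>" "\<rho> \<le> cmod z / 2"
    show "measure N (ball z \<rho>) \<le> e * (\<rho> / cmod z) powr \<beta>"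
    proof (rule ccontr)
      assume "\<not> ?thesis"
      then have "(z, \<rho>) \<in> K"
        unfolding K_def using z \<rho> by auto
      then have "z \<in> (\<Union>p\<in>K. ball (fst p) (snd p))"
        using \<rho> by force
      then have "z \<in> (\<Union>p\<in>C. ball (fst p) (5 * snd p))"
        using C(4) by blast
      then show False
        using z(4) by (auto simp: case_prod_unfold)
    qed
  qed
qed

lemma dyadic_bracket:
  fixes x :: real
  assumes "x \<ge> 1"
  obtains k :: nat where "2 ^ k \<le> x" "x < 2 ^ (k + 1)"
proof -
  obtain n where n: "x < 2 ^ n"
    using real_arch_pow[of 2 x] by auto
  define i where "i = (LEAST n. x < 2 ^ n)"
  have i: "x < 2 ^ i" "\<And>j. j < i \<Longrightarrow> x \<ge> 2 ^ j"
    unfolding i_def using n LeastI[of "\<lambda>n. x < 2 ^ n" n] not_less_Least[of _ "\<lambda>n. x < 2 ^ n"]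
    by (auto simp: not_less)
  have "i \<noteq> 0"
    using i(1) assms by (intro notI) simp
  then obtain k where "i = k + 1"
    by (metis Suc_eq_plus1 not0_implies_Suc)
  then show ?thesis
    using that[of k] i(1) i(2)[of k] by simp
qed

text \<open>One family serves every \<epsilon>: the threshold \<open>e i\<close> of annulus i tends
  to 0 while the masses divided by \<open>e i\<close> stay summable, so a given \<epsilon> only
  costs finitely many annuli.\<close>

lemma exceptional_discs:
  fixes N :: "complex measure"
  assumes "finite_measure N" "sets N = sets borel" and "\<beta> > 0"
  shows "\<exists>S. admissible_discs \<beta> S \<and> (\<forall>\<epsilon>>0. \<forall>\<^sub>F z in far_outside S.
       \<forall>\<rho>. 0 < \<rho> \<longrightarrow> \<rho> \<le> cmod z / 2 \<longrightarrow> measure N (ball z \<rho>) \<le> \<epsilon> * (\<rho> / cmod z) powr \<beta>)"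
proof -
  define a where "a i = measure N {z. 2 ^ i \<le> cmod z \<and> cmod z < 2 ^ (i + 3)}" for i :: nat
  have "summable a"
    unfolding a_def using assms(1,2) by (rule finite_measure_annuli_summable)
  moreover have a0: "a i \<ge> 0" for i
    by (simp add: a_def)
  ultimately obtain e where e: "\<And>i. e i > 0" "e \<longlonglongrightarrow> 0" "summable (\<lambda>i. a i / e i)"
    using summable_divide_vanishing by blast
  define good where "good i S \<longleftrightarrow> countable S \<and>
    (\<forall>c r. (c, r) \<in> S \<longrightarrow> Im c > 0 \<and> r > 0 \<and> 2 ^ (i + 1) \<le> cmod c \<and> cmod c < 2 ^ (i + 2)) \<and>
    (\<forall>F. finite F \<longrightarrow> F \<subseteq> S \<longrightarrow> (\<Sum>(c, r)\<in>F. (r / cmod c) powr \<beta>) \<le> 5 powr \<beta> * (a i / e i)) \<and>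
    (\<forall>z \<rho>. Im z > 0 \<longrightarrow> 2 ^ (i + 1) \<le> cmod z \<longrightarrow> cmod z < 2 ^ (i + 2) \<longrightarrow>
        z \<notin> (\<Union>(c, r)\<in>S. ball c r) \<longrightarrow> 0 < \<rho> \<longrightarrow> \<rho> \<le> cmod z / 2 \<longrightarrow>
        measure N (ball z \<rho>) \<le> e i * (\<rho> / cmod z) powr \<beta>)" for i S
  have "\<exists>S. good i S" for i
    by (rule annulus_exceptional_discs[OF assms(1,2,3) e(1), of i i])
      (unfold good_def a_def, blast)
  then obtain S where good: "\<And>i. good i (S i)"
    by metis
  have S: "countable (S i)"
    "(c, r) \<in> S i \<Longrightarrow> Im c > 0 \<and> r > 0 \<and> 2 ^ (i + 1) \<le> cmod c \<and> cmod c < 2 ^ (i + 2)"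
    "finite F \<Longrightarrow> F \<subseteq> S i \<Longrightarrow> (\<Sum>(c, r)\<in>F. (r / cmod c) powr \<beta>) \<le> 5 powr \<beta> * (a i / e i)"
    "Im z > 0 \<Longrightarrow> 2 ^ (i + 1) \<le> cmod z \<Longrightarrow> cmod z < 2 ^ (i + 2) \<Longrightarrow>
        z \<notin> (\<Union>(c, r)\<in>S i. ball c r) \<Longrightarrow> 0 < \<rho> \<Longrightarrow> \<rho> \<le> cmod z / 2 \<Longrightarrow>
        measure N (ball z \<rho>) \<le> e i * (\<rho> / cmod z) powr \<beta>" for i c r F z \<rho>
    using good[of i] unfolding good_def by simp_all
  \<comment> \<open>Centres from different annuli differ, so a finite sum over the union of the
    families splits without double counting.\<close>
  have disj: "S i \<inter> S j = {}" if "i < j" for i j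
  proof -
    have "(2::real) ^ (i + 2) \<le> 2 ^ (j + 1)"
      using that by (intro power_increasing) auto
    then show ?thesis
      using S(2)[of _ _ i] S(2)[of _ _ j] by force
  qed
  have summable: "(\<lambda>(c, r). (r / cmod c) powr \<beta>) summable_on (\<Union>i. S i)"
  proof (rule nonneg_bdd_above_summable_on)
    show "bdd_above (sum (\<lambda>(c, r). (r / cmod c) powr \<beta>) ` {F. F \<subseteq> (\<Union>i. S i) \<and> finite F})"
    proof (rule bdd_aboveI2)
      fix F assume "F \<in> {F. F \<subseteq> (\<Union>i. S i) \<and> finite F}"
      then have F: "F \<subseteq> (\<Union>i. S i)" "finite F"
        by auto
      have "\<forall>x\<in>F. \<exists>i. x \<in> S i"
        using F(1) by blast
      from bchoice[OF this] obtain h where h: "\<And>x. x \<in> F \<Longrightarrow> x \<in> S (h x)"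
        by blast
      define I where "I = h ` F"
      have I: "finite I" "F \<subseteq> (\<Union>i\<in>I. S i)"
        using F(2) h unfolding I_def by auto
      then have eq: "F = (\<Union>i\<in>I. F \<inter> S i)"
        by blast
      have "(\<Sum>(c, r)\<in>F. (r / cmod c) powr \<beta>) = (\<Sum>i\<in>I. \<Sum>(c, r)\<in>F \<inter> S i. (r / cmod c) powr \<beta>)"
      proof (subst eq, rule sum.UNION_disjoint)
        show "\<forall>i\<in>I. \<forall>j\<in>I. i \<noteq> j \<longrightarrow> F \<inter> S i \<inter> (F \<inter> S j) = {}"
          using disj by (metis Int_assoc Int_commute Int_empty_right linorder_neqE_nat)
      qed (use I F in auto)
      also have "\<dots> \<le> (\<Sum>i\<in>I. 5 powr \<beta> * (a i / e i))"
        using F by (intro sum_mono S(3)) auto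
      also have "\<dots> \<le> (\<Sum>i. 5 powr \<beta> * (a i / e i))"
        using I e a0 by (intro sum_le_suminf summable_mult) (auto simp: less_imp_le)
      finally show "(\<Sum>(c, r)\<in>F. (r / cmod c) powr \<beta>) \<le> (\<Sum>i. 5 powr \<beta> * (a i / e i))" .
    qed
  qed auto
  show ?thesis
  proof (intro exI[of _ "\<Union>i. S i"] conjI allI impI)
    show "admissible_discs \<beta> (\<Union>i. S i)"
      unfolding admissible_discs_def
    proof (intro conjI summable)
      show "\<forall>p\<in>(\<Union>i. S i). Im (fst p) > 0 \<and> snd p > 0"
        using S(2) by (metis UN_E prod.collapse)
    qed (simp add: S(1))
    fix \<epsilon> :: real assume "\<epsilon> > 0"
    then obtain k where k: "\<And>i. i \<ge> k \<Longrightarrow> e i < \<epsilon>"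
      using order_tendstoD(2)[OF e(2)] unfolding eventually_sequentially by blast
    have "measure N (ball z \<rho>) \<le> \<epsilon> * (\<rho> / cmod z) powr \<beta>"
      if z: "Im z > 0" "cmod z \<ge> 2 ^ (k + 1)" "z \<notin> (\<Union>(c, r)\<in>(\<Union>i. S i). ball c r)" "0 < \<rho>" "\<rho> \<le> cmod z / 2"
      for z \<rho>
    proof -
      \<comment> \<open>Annulus i starts at 2^(i+1), hence the dyadic bracket is applied to
        \<open>cmod z / 2\<close>.\<close>
      have "2 ^ k \<le> cmod z / 2"
        using z(2) by simp
      moreover have "(1::real) \<le> 2 ^ k"
        by simp
      ultimately obtain i where i: "2 ^ i \<le> cmod z / 2" "cmod z / 2 < 2 ^ (i + 1)"
        using dyadic_bracket[of "cmod z / 2"] by (metis order_trans)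
      have "(2::real) ^ k < 2 ^ (i + 1)"
        using \<open>2 ^ k \<le> cmod z / 2\<close> i(2) by linarith
      then have "k \<le> i"
        using power_less_imp_less_exp[of "2::real" k "i + 1"] by simp
      with i have i: "k \<le> i" "2 ^ (i + 1) \<le> cmod z" "cmod z < 2 ^ (i + 2)"
        by auto
      have "measure N (ball z \<rho>) \<le> e i * (\<rho> / cmod z) powr \<beta>"
        using z i by (intro S(4)) auto
      also have "\<dots> \<le> \<epsilon> * (\<rho> / cmod z) powr \<beta>"
        using k[OF i(1)] by (intro mult_right_mono) auto
      finally show ?thesis .
    qed
    then show "\<forall>\<^sub>F z in far_outside (\<Union>i. S i). \<forall>\<rho>. 0 < \<rho> \<longrightarrow> \<rho> \<le> cmod z / 2 \<longrightarrow>
       measure N (ball z \<rho>) \<le> \<epsilon> * (\<rho> / cmod z) powr \<beta>"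
      unfolding eventually_far_outside by blast
  qed
qed

section \<open>Integrals of the majorant\<close>

text \<open>
  Majorizes min (t^2) (t powr \<delta>) with t = Im z / |z - w|. The series diverges at w = z, so that
  it also majorizes the Green function on the diagonal.
\<close>

definition dyadic_kernel :: "real \<Rightarrow> complex \<Rightarrow> complex \<Rightarrow> ennreal" where
  "dyadic_kernel \<delta> z w =
     (\<Sum>k. ennreal (2 powr (\<delta> * (real k + 1))) * indicator (ball z (Im z * 2 / 2 ^ k)) w) +
     (\<Sum>k. ennreal ((1/4) ^ k) * indicator (ball z (Im z * 2 ^ (k + 1))) w)"

text \<open>Bounds a kernel whose weight has already been moved into the measure. Values in
  \<open>ennreal\<close> make the pole on the diagonal an ordinary value.\<close>

definition kernel_majorant :: "nat \<Rightarrow> real \<Rightarrow> complex \<Rightarrow> complex \<Rightarrow> ennreal" where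
  "kernel_majorant m \<delta> z w =
     ennreal (Im z * cmod z ^ m) * ennreal (min 1 ((1 + cmod w) / cmod z)) +
     ennreal (cmod z ^ (m + 2) / Im z) * (indicator (ball z (cmod z / 2)) w * dyadic_kernel \<delta> z w)"

lemma ball_borel_measurable [measurable]: "ball z r \<in> sets (borel :: complex measure)"
  by simp

lemma dyadic_kernel_measurable [measurable]:
  "dyadic_kernel \<delta> z \<in> borel_measurable borel"
  unfolding dyadic_kernel_def by measurable

lemma kernel_majorant_measurable [measurable]:
  "kernel_majorant m \<delta> z \<in> borel_measurable borel"
  unfolding kernel_majorant_def by measurable

lemma ennreal_term_le_suminf: "f k \<le> (\<Sum>k. f k :: ennreal)"
  using sum_le_suminf[of f "{k}"] by simp

text \<open>One term of one series suffices: if |z - w| < Im z, its index is the dyadic size of t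
  and it belongs to the first series; otherwise its index is the dyadic size of 1/t and it belongs
  to the second.\<close>

lemma dyadic_kernel_ge:
  assumes "Im z > 0" "\<delta> \<ge> 0" "w \<noteq> z"
  shows "ennreal (min ((Im z / cmod (z - w))\<^sup>2) ((Im z / cmod (z - w)) powr \<delta>)) \<le> dyadic_kernel \<delta> z w"
proof -
  define r where "r = cmod (z - w)"
  have r: "r > 0"
    using assms by (simp add: r_def)
  show ?thesis
  proof (cases "r < Im z")
    case True
    then obtain k where k: "2 ^ k \<le> Im z / r" "Im z / r < 2 ^ (k + 1)"
      using dyadic_bracket[of "Im z / r"] r by auto
    \<comment> \<open>The bracket yields only \<open>r \<le> Im z / 2 ^ k\<close>; the doubled
      radius places w in the open ball.\<close>
    then have "r < Im z * 2 / 2 ^ k"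
      using r assms by (simp add: field_simps)
    then have "ennreal (2 powr (\<delta> * (real k + 1))) \<le>
        ennreal (2 powr (\<delta> * (real k + 1))) * indicator (ball z (Im z * 2 / 2 ^ k)) w"
      by (simp add: r_def dist_norm)
    also have "\<dots> \<le> dyadic_kernel \<delta> z w"
      unfolding dyadic_kernel_def by (intro add_increasing2 ennreal_term_le_suminf) simp
    finally have *: "ennreal (2 powr (\<delta> * (real k + 1))) \<le> dyadic_kernel \<delta> z w" .
    have "(Im z / r) powr \<delta> \<le> (2 ^ (k + 1)) powr \<delta>"
      using k assms r by (intro powr_mono2) auto
    also have "\<dots> = 2 powr (\<delta> * (real k + 1))"
      by (subst powr_realpow[symmetric]) (simp_all add: powr_powr mult.commute add.commute)
    finally have "ennreal (min ((Im z / r)\<^sup>2) ((Im z / r) powr \<delta>)) \<le> ennreal (2 powr (\<delta> * (real k + 1)))"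
      by (intro ennreal_leI) simp
    with * show ?thesis
      unfolding r_def by (rule order_trans[rotated])
  next
    case False
    then obtain k where k: "2 ^ k \<le> r / Im z" "r / Im z < 2 ^ (k + 1)"
      using dyadic_bracket[of "r / Im z"] assms by auto
    then have "r < Im z * 2 ^ (k + 1)"
      using assms by (simp add: field_simps)
    then have "ennreal ((1/4) ^ k) \<le> ennreal ((1/4) ^ k) * indicator (ball z (Im z * 2 ^ (k + 1))) w"
      by (simp add: r_def dist_norm)
    also have "\<dots> \<le> dyadic_kernel \<delta> z w"
      unfolding dyadic_kernel_def by (intro add_increasing ennreal_term_le_suminf) simp
    finally have *: "ennreal ((1/4) ^ k) \<le> dyadic_kernel \<delta> z w" .
    have "Im z / r \<le> (1/2) ^ k"
      using k(1) r assms by (simp add: field_simps)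
    then have "(Im z / r)\<^sup>2 \<le> ((1/2) ^ k)\<^sup>2"
      using r assms by (intro power_mono) auto
    also have "\<dots> = (1/4) ^ k"
      by (simp add: power_mult[symmetric] mult.commute[of k]) (simp add: power_mult power2_eq_square)
    finally have "ennreal (min ((Im z / r)\<^sup>2) ((Im z / r) powr \<delta>)) \<le> ennreal ((1/4) ^ k)"
      by (intro ennreal_leI) simp
    with * show ?thesis
      unfolding r_def by (rule order_trans[rotated])
  qed
qed

text \<open>z is the centre of all balls of the first series, and since \<delta> \<ge> 0 no
  coefficient is below 1.\<close>

lemma dyadic_kernel_diag:
  assumes "Im z > 0" "\<delta> \<ge> 0"
  shows "dyadic_kernel \<delta> z z = \<infinity>"
proof -
  let ?f = "\<lambda>k. ennreal (2 powr (\<delta> * (real k + 1))) * indicator (ball z (Im z * 2 / 2 ^ k)) z"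
  have ge1: "1 \<le> ?f k" for k
    using assms by (simp add: ge_one_powr_ge_zero)
  have "of_nat n \<le> (\<Sum>k. ?f k)" for n
  proof -
    have "of_nat n = (\<Sum>k<n. 1 :: ennreal)"
      by simp
    also have "\<dots> \<le> (\<Sum>k<n. ?f k)"
      by (intro sum_mono ge1)
    also have "\<dots> \<le> (\<Sum>k. ?f k)"
      by (intro sum_le_suminf) auto
    finally show ?thesis .
  qed
  then have "\<not> (\<Sum>k. ?f k) < top"
    using ennreal_Ex_less_of_nat[of "\<Sum>k. ?f k"] by (auto simp only: not_less[symmetric])
  then have "(\<Sum>k. ?f k) = top"
    by (simp only: less_top[symmetric] not_not)
  then show ?thesis
    unfolding dyadic_kernel_def by simp
qed

lemma nn_integral_ball_series_le:
  fixes N :: "complex measure"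
  assumes "finite_measure N" and [measurable_cong]: "sets N = sets borel"
    and "e \<ge> 0" "\<beta> > 0" "z \<noteq> 0"
    and small: "\<And>\<rho>. 0 < \<rho> \<Longrightarrow> \<rho> \<le> cmod z / 2 \<Longrightarrow> measure N (ball z \<rho>) \<le> e * (\<rho> / cmod z) powr \<beta>"
    and c: "\<And>k. c k \<ge> 0" and r: "\<And>k. r k > 0"
    and sums: "(\<lambda>k. c k * (r k / cmod z) powr \<beta>) sums s"
  shows "(\<integral>\<^sup>+w. indicator (ball z (cmod z / 2)) w * (\<Sum>k. ennreal (c k) * indicator (ball z (r k)) w) \<partial>N)
           \<le> ennreal (e * s)"
proof -
  interpret finite_measure N by fact
  let ?B = "ball z (cmod z / 2)"
  \<comment> \<open>The indicator cuts larger balls down to radius |z|/2, where the hypothesis still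
    applies, and the power only grows with the radius. So the growth bound may be used at every
    scale of the series.\<close>
  have all: "measure N (?B \<inter> ball z \<rho>) \<le> e * (\<rho> / cmod z) powr \<beta>" if "\<rho> > 0" for \<rho>
  proof (cases "\<rho> \<le> cmod z / 2")
    case True
    have "measure N (?B \<inter> ball z \<rho>) \<le> measure N (ball z \<rho>)"
      by (intro finite_measure_mono) auto
    then show ?thesis
      using small[OF that True] by simp
  next
    case False
    have "measure N (?B \<inter> ball z \<rho>) \<le> measure N ?B"
      by (intro finite_measure_mono) auto
    also have "\<dots> \<le> e * ((cmod z / 2) / cmod z) powr \<beta>"
      using \<open>z \<noteq> 0\<close> by (intro small) auto
    also have "\<dots> \<le> e * (\<rho> / cmod z) powr \<beta>"
      using False assms by (intro mult_left_mono powr_mono2 divide_right_mono) auto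
    finally show ?thesis .
  qed
  have "(\<integral>\<^sup>+w. indicator ?B w * (\<Sum>k. ennreal (c k) * indicator (ball z (r k)) w) \<partial>N)
      = (\<integral>\<^sup>+w. (\<Sum>k. ennreal (c k) * indicator (?B \<inter> ball z (r k)) w) \<partial>N)"
    by (intro nn_integral_cong) (simp add: indicator_inter_arith split: split_indicator)
  also have "\<dots> = (\<Sum>k. \<integral>\<^sup>+w. ennreal (c k) * indicator (?B \<inter> ball z (r k)) w \<partial>N)"
    by (intro nn_integral_suminf) measurable
  also have "\<dots> = (\<Sum>k. ennreal (c k) * emeasure N (?B \<inter> ball z (r k)))"
    by (intro suminf_cong nn_integral_cmult_indicator) simp
  also have "\<dots> \<le> (\<Sum>k. ennreal (e * (c k * (r k / cmod z) powr \<beta>)))"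
  proof (intro suminf_le)
    fix k
    have "ennreal (c k) * emeasure N (?B \<inter> ball z (r k)) = ennreal (c k * measure N (?B \<inter> ball z (r k)))"
      using c by (simp add: emeasure_eq_measure ennreal_mult)
    also have "\<dots> \<le> ennreal (c k * (e * (r k / cmod z) powr \<beta>))"
      using c all[OF r] by (intro ennreal_leI mult_left_mono) auto
    finally show "ennreal (c k) * emeasure N (?B \<inter> ball z (r k)) \<le> ennreal (e * (c k * (r k / cmod z) powr \<beta>))"
      by (simp add: mult_ac)
  qed auto
  also have "\<dots> = ennreal (e * s)"
    using c \<open>e \<ge> 0\<close> sums by (intro suminf_ennreal_eq sums_mult) auto
  finally show ?thesis .
qed

text \<open>The constant precedes the measure, e and z, so that e can later be chosen in terms of
  it.\<close>

lemma nn_integral_dyadic_kernel_le: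
  assumes \<delta>: "\<delta> < \<beta>" and \<beta>: "0 < \<beta>" "\<beta> < 2"
  obtains C where "C > 0"
    "\<And>(N :: complex measure) e z. finite_measure N \<Longrightarrow> sets N = sets borel \<Longrightarrow> e \<ge> 0 \<Longrightarrow> Im z > 0 \<Longrightarrow>
       (\<And>\<rho>. 0 < \<rho> \<Longrightarrow> \<rho> \<le> cmod z / 2 \<Longrightarrow> measure N (ball z \<rho>) \<le> e * (\<rho> / cmod z) powr \<beta>) \<Longrightarrow>
       (\<integral>\<^sup>+w. indicator (ball z (cmod z / 2)) w * dyadic_kernel \<delta> z w \<partial>N)
         \<le> ennreal (C * e * (Im z / cmod z) powr \<beta>)"
proof -
  \<comment> \<open>First term over one minus ratio for each of the two geometric series, with the
    common factor (Im z/|z|)^\<beta> taken out.\<close>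
  define C1 where "C1 = 2 powr (\<delta> + \<beta>) / (1 - 2 powr (\<delta> - \<beta>))"
  define C2 where "C2 = 2 powr \<beta> / (1 - 2 powr (\<beta> - 2))"
  have q: "2 powr (\<delta> - \<beta>) < (1::real)" "2 powr (\<beta> - 2) < (1::real)"
    using \<delta> \<beta> by (auto simp: powr_less_one)
  have C: "C1 > 0" "C2 > 0"
    unfolding C1_def C2_def using q by auto
  have geom: "(\<lambda>k. A * q ^ k) sums (A / (1 - q))" if "0 \<le> q" "q < 1" for A q :: real
    using sums_mult[OF geometric_sums[of q], of A] that by simp
  show ?thesis
  proof (rule that[of "C1 + C2"])
    show "C1 + C2 > 0"
      using C by simp
    fix N :: "complex measure" and e z
    assume N: "finite_measure N" and sN [measurable_cong]: "sets N = sets borel" and e: "e \<ge> 0" and z: "Im z > 0"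
      and small: "\<And>\<rho>. 0 < \<rho> \<Longrightarrow> \<rho> \<le> cmod z / 2 \<Longrightarrow> measure N (ball z \<rho>) \<le> e * (\<rho> / cmod z) powr \<beta>"
    define P where "P = (Im z / cmod z) powr \<beta>"
    have z0: "z \<noteq> 0" "cmod z > 0"
      using z by auto
    have pw: "(2::real) ^ k = 2 powr real k" for k
      by (simp add: powr_realpow)
    let ?B = "ball z (cmod z / 2)"
    let ?f = "\<lambda>w. \<Sum>k. ennreal (2 powr (\<delta> * (real k + 1))) * indicator (ball z (Im z * 2 / 2 ^ k)) w"
    let ?g = "\<lambda>w. \<Sum>k. ennreal ((1/4) ^ k) * indicator (ball z (Im z * 2 ^ (k + 1))) w"
    have "(\<integral>\<^sup>+w. indicator ?B w * dyadic_kernel \<delta> z w \<partial>N)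
      = (\<integral>\<^sup>+w. indicator ?B w * ?f w \<partial>N) + (\<integral>\<^sup>+w. indicator ?B w * ?g w \<partial>N)"
      unfolding dyadic_kernel_def by (subst nn_integral_add[symmetric]) (measurable, simp add: distrib_left)
    also have "\<dots> \<le> ennreal (e * (C1 * P)) + ennreal (e * (C2 * P))"
    proof (intro add_mono nn_integral_ball_series_le[OF N sN e \<beta>(1) z0(1) small])
      have "2 powr (\<delta> * (real k + 1)) * (Im z * 2 / 2 ^ k / cmod z) powr \<beta> = 2 powr (\<delta> + \<beta>) * P * (2 powr (\<delta> - \<beta>)) ^ k" for k
      proof -
        have "(Im z * 2 / 2 ^ k / cmod z) powr \<beta> = P * 2 powr \<beta> / (2 powr (real k * \<beta>))"
          unfolding P_def using z z0 by (simp add: powr_divide powr_mult pw powr_powr)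
        moreover have "(2 powr (\<delta> - \<beta>)) ^ k = (2::real) powr (\<delta> * real k) / 2 powr (real k * \<beta>)"
          by (simp add: powr_power powr_diff[symmetric] algebra_simps)
        moreover have "(2::real) powr (\<delta> * (real k + 1)) = 2 powr \<delta> * 2 powr (\<delta> * real k)"
          by (simp add: powr_add[symmetric] algebra_simps)
        ultimately show ?thesis
          by (simp add: powr_add)
      qed
      then show "(\<lambda>k. 2 powr (\<delta> * (real k + 1)) * (Im z * 2 / 2 ^ k / cmod z) powr \<beta>) sums (C1 * P)"
        using geom[of "2 powr (\<delta> - \<beta>)" "2 powr (\<delta> + \<beta>) * P"] q unfolding C1_def by simp
      have "(1/4) ^ k * (Im z * 2 ^ (k + 1) / cmod z) powr \<beta> = 2 powr \<beta> * P * (2 powr (\<beta> - 2)) ^ k" for k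
      proof -
        have "(Im z * 2 ^ (k + 1) / cmod z) powr \<beta> = P * 2 powr ((real k + 1) * \<beta>)"
          unfolding P_def using z z0 by (simp only: powr_divide powr_mult pw powr_powr) (simp add: add.commute)
        moreover have "(1/4::real) ^ k = 2 powr (- 2 * real k)"
          by (simp add: powr_minus powr_realpow[symmetric] power_one_over powr_powr[symmetric] inverse_eq_divide
              flip: powr_powr)
        moreover have "(2 powr (\<beta> - 2)) ^ k = (2::real) powr (\<beta> * real k) * 2 powr (- 2 * real k)"
          by (simp add: powr_power powr_add[symmetric] algebra_simps)
        moreover have "(2::real) powr ((real k + 1) * \<beta>) = 2 powr \<beta> * 2 powr (\<beta> * real k)"
          by (simp add: powr_add[symmetric] algebra_simps)
        ultimately show ?thesis
          by simp
      qed
      then show "(\<lambda>k. (1/4) ^ k * (Im z * 2 ^ (k + 1) / cmod z) powr \<beta>) sums (C2 * P)"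
        using geom[of "2 powr (\<beta> - 2)" "2 powr \<beta> * P"] q unfolding C2_def by simp
    qed (use z in auto)
    also have "\<dots> = ennreal ((C1 + C2) * e * P)"
      using e C by (simp add: ennreal_plus[symmetric] P_def algebra_simps del: ennreal_plus)
    finally show "(\<integral>\<^sup>+w. indicator ?B w * dyadic_kernel \<delta> z w \<partial>N) \<le> ennreal ((C1 + C2) * e * (Im z / cmod z) powr \<beta>)"
      unfolding P_def .
  qed
qed

text \<open>Dominated convergence with majorant 1, integrable because N is finite. The limit is
  taken in a real variable t standing for |z|, which makes the result uniform in the argument of
  z.\<close>

lemma nn_integral_truncated_ratio_small:
  fixes N :: "complex measure"
  assumes "finite_measure N" and [measurable_cong]: "sets N = sets borel" and "\<epsilon> > 0"
  shows "\<exists>R. \<forall>z. cmod z \<ge> R \<longrightarrow> (\<integral>\<^sup>+w. ennreal (min 1 ((1 + cmod w) / cmod z)) \<partial>N) \<le> ennreal \<epsilon>"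
proof -
  interpret finite_measure N by fact
  let ?s = "\<lambda>t w. min 1 ((1 + cmod w) / t)"
  have bounded: "norm (?s t w) \<le> 1" if "t \<ge> 0" for t w
  proof -
    have "0 \<le> (1 + cmod w) / t"
      using that by simp
    then show ?thesis
      by (simp add: abs_le_iff)
  qed
  have lim: "((\<lambda>t. \<integral>w. ?s t w \<partial>N) \<longlongrightarrow> (\<integral>w. 0 \<partial>N)) at_top"
  proof (rule integral_dominated_convergence_at_top[where w = "\<lambda>_. 1"])
    show "\<forall>\<^sub>F t in at_top. AE w in N. norm (?s t w) \<le> 1"
      using eventually_gt_at_top[of 0] by eventually_elim (intro AE_I2 bounded, simp)
    have "((\<lambda>t. ?s t w) \<longlongrightarrow> min 1 0) at_top" for w
      by (intro tendsto_min tendsto_const tendsto_divide_0[OF tendsto_const] filterlim_at_top_imp_at_infinity filterlim_ident)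
    then show "AE w in N. ((\<lambda>t. ?s t w) \<longlongrightarrow> 0) at_top"
      by simp
  qed simp_all
  then have "\<forall>\<^sub>F t in at_top. (\<integral>w. ?s t w \<partial>N) < \<epsilon>"
    using \<open>\<epsilon> > 0\<close> by (intro order_tendstoD) auto
  then obtain R where R: "\<And>t. t \<ge> R \<Longrightarrow> (\<integral>w. ?s t w \<partial>N) < \<epsilon>"
    unfolding eventually_at_top_linorder by blast
  have "(\<integral>\<^sup>+w. ennreal (?s (cmod z) w) \<partial>N) \<le> ennreal \<epsilon>" if "cmod z \<ge> R" for z
  proof -
    have "integrable N (\<lambda>w. ?s (cmod z) w)"
      by (intro integrable_const_bound[where B = 1] AE_I2 bounded) simp_all
    then have "(\<integral>\<^sup>+w. ennreal (?s (cmod z) w) \<partial>N) = ennreal (\<integral>w. ?s (cmod z) w \<partial>N)"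
      by (intro nn_integral_eq_integral) auto
    then show ?thesis
      using R[OF that] by (simp add: ennreal_leI)
  qed
  then show ?thesis
    by blast
qed

lemma kernel_majorant_integral_small:
  fixes N :: "complex measure"
  assumes N: "finite_measure N" and sN [measurable_cong]: "sets N = sets borel"
    and \<alpha>: "0 < \<alpha>" "\<alpha> < 2"
  shows "\<exists>S. admissible_discs (2 - \<alpha>) S \<and> (\<forall>\<epsilon>>0. \<forall>\<^sub>F z in far_outside S.
       (\<integral>\<^sup>+w. kernel_majorant m (1 - \<alpha> / 2) z w \<partial>N)
         \<le> ennreal (\<epsilon> * (Im z powr (1 - \<alpha>) * cmod z powr (real m + \<alpha>))))"
proof -
  \<comment> \<open>Half of 2 - \<alpha>: it lies below that exponent, and in (0, 1), as the bound
    for the Green function requires.\<close>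
  define \<delta> where "\<delta> = 1 - \<alpha> / 2"
  have \<beta>: "\<delta> < 2 - \<alpha>" "0 < 2 - \<alpha>" "2 - \<alpha> < 2"
    using \<alpha> by (auto simp: \<delta>_def)
  obtain C where C: "C > 0"
    "\<And>(N :: complex measure) e z. finite_measure N \<Longrightarrow> sets N = sets borel \<Longrightarrow> e \<ge> 0 \<Longrightarrow> Im z > 0 \<Longrightarrow>
       (\<And>\<rho>. 0 < \<rho> \<Longrightarrow> \<rho> \<le> cmod z / 2 \<Longrightarrow> measure N (ball z \<rho>) \<le> e * (\<rho> / cmod z) powr (2 - \<alpha>)) \<Longrightarrow>
       (\<integral>\<^sup>+w. indicator (ball z (cmod z / 2)) w * dyadic_kernel \<delta> z w \<partial>N)
         \<le> ennreal (C * e * (Im z / cmod z) powr (2 - \<alpha>))"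
    by (rule nn_integral_dyadic_kernel_le[OF \<beta>]) blast
  obtain S where S: "admissible_discs (2 - \<alpha>) S"
    "\<And>\<epsilon>. \<epsilon> > 0 \<Longrightarrow> \<forall>\<^sub>F z in far_outside S. \<forall>\<rho>. 0 < \<rho> \<longrightarrow> \<rho> \<le> cmod z / 2 \<longrightarrow>
       measure N (ball z \<rho>) \<le> \<epsilon> * (\<rho> / cmod z) powr (2 - \<alpha>)"
    using exceptional_discs[OF N sN \<beta>(2)] by blast
  show ?thesis
  proof (intro exI[of _ S] conjI S(1) allI impI)
    fix \<epsilon> :: real assume \<epsilon>: "\<epsilon> > 0"
    \<comment> \<open>Cancels C, so that the singular part receives \<epsilon>/2; the choice of R
      leaves the other half to the regular part.\<close>
    define e where "e = \<epsilon> / (2 * C)"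
    have e: "e > 0" "C * e = \<epsilon> / 2"
      using \<epsilon> C(1) by (auto simp: e_def)
    obtain R where R: "\<And>z. cmod z \<ge> R \<Longrightarrow> (\<integral>\<^sup>+w. ennreal (min 1 ((1 + cmod w) / cmod z)) \<partial>N) \<le> ennreal (\<epsilon> / 2)"
      using nn_integral_truncated_ratio_small[OF N sN, of "\<epsilon> / 2"] \<epsilon> by auto
    show "\<forall>\<^sub>F z in far_outside S. (\<integral>\<^sup>+w. kernel_majorant m (1 - \<alpha> / 2) z w \<partial>N)
         \<le> ennreal (\<epsilon> * (Im z powr (1 - \<alpha>) * cmod z powr (real m + \<alpha>)))"
      using S(2)[OF e(1)] eventually_far_outside_basic[of R]
    proof eventually_elim
      case (elim z)
      then have z: "Im z > 0" "cmod z \<ge> R" and z0: "cmod z > 0"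
        by auto
      let ?Q = "Im z powr (1 - \<alpha>) * cmod z powr (real m + \<alpha>)"
      have I1: "(\<integral>\<^sup>+w. ennreal (min 1 ((1 + cmod w) / cmod z)) \<partial>N) \<le> ennreal (\<epsilon> / 2)"
        using R z by simp
      have I2: "(\<integral>\<^sup>+w. indicator (ball z (cmod z / 2)) w * dyadic_kernel \<delta> z w \<partial>N)
         \<le> ennreal (C * e * (Im z / cmod z) powr (2 - \<alpha>))"
      proof (rule C(2)[OF N sN _ z(1)])
        show "measure N (ball z \<rho>) \<le> e * (\<rho> / cmod z) powr (2 - \<alpha>)" if "0 < \<rho>" "\<rho> \<le> cmod z / 2" for \<rho>
          using elim that by blast
      qed (use e in simp)
      \<comment> \<open>As Im z \<le> |z| and \<alpha> > 0, the regular part is of no larger order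
        than the claimed bound.\<close>
      have Q1: "Im z * cmod z ^ m \<le> ?Q"
      proof -
        have "Im z * cmod z ^ m = Im z powr (1 - \<alpha>) * (Im z powr \<alpha> * cmod z powr real m)"
          using z z0 by (simp add: powr_realpow powr_add[symmetric] mult.assoc[symmetric])
        also have "\<dots> \<le> Im z powr (1 - \<alpha>) * (cmod z powr \<alpha> * cmod z powr real m)"
          using z \<alpha> abs_Im_le_cmod[of z] by (intro mult_left_mono mult_right_mono powr_mono2) auto
        finally show ?thesis
          by (simp add: powr_add mult_ac)
      qed
      \<comment> \<open>The exponents of the claim originate here: |z| collects m + 2 - (2 -
        \<alpha>) = m + \<alpha>, and y collects (2 - \<alpha>) - 1 = 1 - \<alpha>.\<close>
      have Q2: "cmod z ^ (m + 2) / Im z * (Im z / cmod z) powr (2 - \<alpha>) = ?Q"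
      proof -
        have "cmod z ^ (m + 2) / Im z * (Im z / cmod z) powr (2 - \<alpha>)
          = cmod z powr (real m + 2) / Im z powr 1 * (Im z powr (2 - \<alpha>) / cmod z powr (2 - \<alpha>))"
          using z z0 powr_realpow[of "cmod z" "m + 2"] by (simp add: powr_divide add.commute)
        also have "\<dots> = (Im z powr (2 - \<alpha>) / Im z powr 1) * (cmod z powr (real m + 2) / cmod z powr (2 - \<alpha>))"
          by simp
        also have "\<dots> = ?Q"
          by (simp only: powr_diff[symmetric]) (simp add: algebra_simps)
        finally show ?thesis .
      qed
      have "(\<integral>\<^sup>+w. kernel_majorant m \<delta> z w \<partial>N)
        = ennreal (Im z * cmod z ^ m) * (\<integral>\<^sup>+w. ennreal (min 1 ((1 + cmod w) / cmod z)) \<partial>N) +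
          ennreal (cmod z ^ (m + 2) / Im z) * (\<integral>\<^sup>+w. indicator (ball z (cmod z / 2)) w * dyadic_kernel \<delta> z w \<partial>N)"
        unfolding kernel_majorant_def by (simp add: nn_integral_add nn_integral_cmult)
      also have "\<dots> \<le> ennreal (Im z * cmod z ^ m) * ennreal (\<epsilon> / 2) +
          ennreal (cmod z ^ (m + 2) / Im z) * ennreal (C * e * (Im z / cmod z) powr (2 - \<alpha>))"
        using I1 I2 by (intro add_mono mult_left_mono) auto
      also have "\<dots> = ennreal (Im z * cmod z ^ m * (\<epsilon> / 2)) +
          ennreal (cmod z ^ (m + 2) / Im z * (C * e * (Im z / cmod z) powr (2 - \<alpha>)))"
        using z \<epsilon> e C(1) by (intro arg_cong2[where f = "(+)"] ennreal_mult[symmetric]) auto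
      also have "\<dots> = ennreal (Im z * cmod z ^ m * (\<epsilon> / 2) +
          cmod z ^ (m + 2) / Im z * (C * e * (Im z / cmod z) powr (2 - \<alpha>)))"
        using z \<epsilon> e C(1) by (intro ennreal_plus[symmetric]) auto
      also have "\<dots> = ennreal (Im z * cmod z ^ m * (\<epsilon> / 2) +
          \<epsilon> / 2 * (cmod z ^ (m + 2) / Im z * (Im z / cmod z) powr (2 - \<alpha>)))"
        unfolding e(2) by (simp only: mult_ac)
      also have "\<dots> \<le> ennreal (\<epsilon> * ?Q)"
        unfolding Q2 using mult_right_mono[OF Q1, of "\<epsilon> / 2"] \<epsilon> by (intro ennreal_leI) (simp add: field_simps)
      finally show ?case
        unfolding \<delta>_def .
    qed
  qed
qed

section \<open>Kernels minus Taylor polynomials\<close>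

text \<open>Induction by Im (z z^k) = Re z Im z^k + Im z Re z^k. The factor Im z gained over the
  trivial bound |z|^k makes the subtracted polynomials vanish to order y at the real axis, as the
  kernels do.\<close>

lemma abs_Im_power_le: "\<bar>Im (z ^ k)\<bar> \<le> real k * \<bar>Im z\<bar> * cmod z ^ (k - 1)"
proof (induction k)
  case (Suc k)
  show ?case
  \<comment> \<open>Separates k = 0, where \<open>k - 1\<close> is truncated.\<close>
  proof (cases k)
    case (Suc j)
    have "\<bar>Im (z ^ Suc k)\<bar> \<le> \<bar>Re z\<bar> * \<bar>Im (z ^ k)\<bar> + \<bar>Im z\<bar> * \<bar>Re (z ^ k)\<bar>"
      by (simp add: abs_mult[symmetric] add.commute abs_triangle_ineq)
    also have "\<dots> \<le> cmod z * (real k * \<bar>Im z\<bar> * cmod z ^ (k - 1)) + \<bar>Im z\<bar> * cmod z ^ k"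
      using Suc.IH abs_Re_le_cmod[of z] abs_Re_le_cmod[of "z ^ k"]
      by (intro add_mono mult_mono) (auto simp: norm_power)
    also have "\<dots> = real (Suc k) * \<bar>Im z\<bar> * cmod z ^ (Suc k - 1)"
      using Suc by (simp add: algebra_simps)
    finally show ?thesis .
  qed simp
qed simp

lemma one_plus_power_le:
  fixes x :: real
  assumes "x \<ge> 0"
  shows "1 + x ^ (m + 2) \<le> (1 + x) ^ (m + 2)"
proof -
  have "1 + x ^ Suc n \<le> (1 + x) ^ Suc n" for n
  proof (induction n)
    case (Suc n)
    have "1 + x ^ Suc (Suc n) \<le> (1 + x) * (1 + x ^ Suc n)"
      using assms by (simp add: algebra_simps)
    also have "\<dots> \<le> (1 + x) * (1 + x) ^ Suc n"
      using Suc assms by (intro mult_left_mono) auto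
    finally show ?case
      by simp
  qed simp
  from this[of "m + 1"] show ?thesis
    by simp
qed

text \<open>
  A kernel K0 = \<Sum>k. T k (for |w| large), of which K omits the terms up to m when |w| > 1; the weight
  L is 1 for the Poisson kernel and Im w for the Green function.
\<close>

locale modified_kernel =
  fixes z w :: complex and L c \<delta> K K0 :: real and T :: "nat \<Rightarrow> real" and m :: nat
  assumes Im_pos: "Im z > 0" and z_ge: "cmod z \<ge> 2" and w_neq: "w \<noteq> z"
    and L_nonneg: "L \<ge> 0" and c_nonneg: "c \<ge> 0" and \<delta>_nonneg: "\<delta> \<ge> 0"
    and T_le: "\<And>k. w \<noteq> 0 \<Longrightarrow> \<bar>T k\<bar> \<le> L * (real k * Im z * cmod z ^ (k - 1) / cmod w ^ (k + 1))"
    and T_sums: "2 * cmod z \<le> cmod w \<Longrightarrow> T sums K0"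
    and K0_le: "\<bar>K0\<bar> \<le> c * L / Im z * min ((Im z / cmod (z - w))\<^sup>2) ((Im z / cmod (z - w)) powr \<delta>)"
    and K_eq: "K = (if cmod w \<le> 1 then K0 else K0 - (\<Sum>k\<le>m. T k))"
begin

lemma z_nz: "z \<noteq> 0" "cmod z > 0"
  using Im_pos by auto

text \<open>The quotient that the majorant truncates at 1. For |w| < 2|z| one factor of it is saved
  away from the singularity, and this factor produces the decay as |z| grows.\<close>

definition q where "q = (1 + cmod w) / cmod z"

lemma q_pos: "q > 0"
  unfolding q_def using z_ge by (intro divide_pos_pos add_pos_nonneg) auto

text \<open>Here K is the tail of the expansion from index m + 1 on, and |z|/|w| \<le> 1/2 compares
  it with the series of (j + 1)/2^j, whose sum is 4. The 8 is this 4 times the 2 from 1 + |w|^(m+2)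
  \<le> 2 |w|^(m+2).\<close>

lemma tail_le:
  assumes "2 * cmod z \<le> cmod w"
  shows "(1 + cmod w ^ (m + 2)) * \<bar>K\<bar> \<le> 8 * (real m + 1) * L * (Im z * cmod z ^ m * min 1 q)"
proof -
  have w: "cmod w > 1"
    using assms z_ge by linarith
  then have w0: "w \<noteq> 0"
    by auto
  \<comment> \<open>No decay is gained in this region, where the truncation gives 1; smallness comes
    from integrating over a region that recedes to infinity.\<close>
  have min1: "min 1 q = 1"
  proof -
    have "q \<ge> 1"
      unfolding q_def using assms z_nz(2) z_ge by (simp add: le_divide_eq_1_pos del: zero_less_norm_iff)
    then show ?thesis
      by simp
  qed
  let ?A = "L * Im z * cmod z ^ m / cmod w ^ (m + 2)"
  have term_le: "\<bar>T (j + Suc m)\<bar> \<le> ?A * (real m + 1) * (real (Suc j) * (1/2) ^ j)" for j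
  proof -
    have "\<bar>T (j + Suc m)\<bar> \<le> L * (real (j + Suc m) * Im z * cmod z ^ (j + m) / cmod w ^ (j + m + 2))"
      using T_le[OF w0, of "j + Suc m"] by simp
    also have "\<dots> = ?A * real (j + Suc m) * (cmod z / cmod w) ^ j"
      by (simp add: power_add power_divide mult_ac)
    also have "\<dots> \<le> ?A * real (j + Suc m) * (1/2) ^ j"
    proof -
      have "cmod z / cmod w \<le> 1 / 2"
        using assms w by (subst pos_divide_le_eq) auto
      then show ?thesis
        using Im_pos L_nonneg by (intro mult_left_mono power_mono) auto
    qed
    also have "\<dots> \<le> ?A * ((real m + 1) * real (Suc j)) * (1/2) ^ j"
      using Im_pos L_nonneg by (intro mult_left_mono mult_right_mono) (auto simp: algebra_simps)
    finally show ?thesis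
      by (simp add: mult_ac)
  qed
  have "(\<lambda>j. real (Suc j) * (1/2) ^ j) sums 4"
    using geometric_deriv_sums[of "1/2 :: real"] by (simp add: power2_eq_square)
  then have maj: "(\<lambda>j. ?A * (real m + 1) * (real (Suc j) * (1/2) ^ j)) sums (?A * (real m + 1) * 4)"
    by (rule sums_mult)
  have K: "K = (\<Sum>j. T (j + Suc m))"
    using w sums_split_initial_segment[OF T_sums[OF assms], of "Suc m"] K_eq
    by (simp add: sums_iff lessThan_Suc_atMost)
  have "\<bar>K\<bar> \<le> (\<Sum>j. ?A * (real m + 1) * (real (Suc j) * (1/2) ^ j))"
    unfolding K real_norm_def[symmetric] using sums_summable[OF maj] term_le
    by (intro norm_suminf_le) auto
  also have "\<dots> = ?A * (real m + 1) * 4"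
    using maj by (rule sums_unique[symmetric])
  finally have "(1 + cmod w ^ (m + 2)) * \<bar>K\<bar> \<le> (2 * cmod w ^ (m + 2)) * (?A * (real m + 1) * 4)"
    using w L_nonneg Im_pos one_le_power[of "cmod w" "m + 2"] by (intro mult_mono) auto
  also have "\<dots> = 8 * (real m + 1) * L * (Im z * cmod z ^ m * min 1 q)"
  proof -
    have "(2 * X) * (L * Im z * A / X * (real m + 1) * 4) = 8 * (real m + 1) * L * (Im z * A * 1)" if "X \<noteq> 0" for X A
      using that by simp
    then show ?thesis
      unfolding min1 using w0 by simp
  qed
  finally show ?thesis .
qed

lemma q_le_3: "cmod w < 2 * cmod z \<Longrightarrow> q \<le> 3"
  unfolding q_def using z_ge by (simp add: divide_le_eq)

text \<open>Of the m + 2 factors q, all but one are estimated by 3; the last is kept as 3 min 1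
  q.\<close>

lemma weight_le: "cmod w < 2 * cmod z \<Longrightarrow> 1 + cmod w ^ (m + 2) \<le> cmod z ^ (m + 2) * (3 ^ (m + 2) * min 1 q)"
proof -
  assume w: "cmod w < 2 * cmod z"
  have "1 + cmod w ^ (m + 2) \<le> (1 + cmod w) ^ (m + 2)"
    by (rule one_plus_power_le) simp
  also have "\<dots> = cmod z ^ (m + 2) * (q * q ^ (m + 1))"
    unfolding q_def using z_nz by (simp add: power_divide)
  also have "\<dots> \<le> cmod z ^ (m + 2) * ((3 * min 1 q) * 3 ^ (m + 1))"
    using q_pos q_le_3[OF w] by (intro mult_left_mono mult_mono power_mono) (auto simp: min_def)
  finally show ?thesis
    by (simp add: mult_ac)
qed

text \<open>After multiplication by the weight, the term of index k is at most a multiple of L y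
  |z|^m r^(m-k+1) with r = |w|/|z| \<le> 2. As k \<le> m, one power of r remains and is traded for 2
  min 1 q; m is the last degree for which this works.\<close>

lemma polynomial_part_le:
  assumes "1 < cmod w" "cmod w < 2 * cmod z"
  shows "(1 + cmod w ^ (m + 2)) * \<bar>\<Sum>k\<le>m. T k\<bar>
    \<le> (real m + 1) * real m * 2 ^ (m + 2) * L * (Im z * cmod z ^ m * min 1 q)"
proof -
  have term_le: "(1 + cmod w ^ (m + 2)) * \<bar>T k\<bar> \<le> real m * 2 ^ (m + 2) * L * (Im z * cmod z ^ m * min 1 q)"
    if "k \<le> m" for k
  proof (cases "k = 0")
    \<comment> \<open>The bound on \<open>T 0\<close> carries the factor k = 0, so the constant term
      vanishes.\<close>
    case True
    have "w \<noteq> 0"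
      using assms by auto
    then have "T k = 0"
      using T_le[of 0] True by simp
    then show ?thesis
      using Im_pos L_nonneg q_pos by simp
  next
    case False
    define r where "r = cmod w / cmod z"
    have r: "0 \<le> r" "r \<le> 2" "r \<le> 2 * min 1 q"
    proof -
      show "0 \<le> r" and r2: "r \<le> 2"
        unfolding r_def using assms z_nz(2) by (auto simp: pos_divide_le_eq simp del: zero_less_norm_iff)
      have "r \<le> q"
        unfolding r_def q_def by (intro divide_right_mono) auto
      then show "r \<le> 2 * min 1 q"
        using r2 q_pos by (auto simp: min_def)
    qed
    have "(1 + cmod w ^ (m + 2)) * \<bar>T k\<bar> \<le>
      (2 * cmod w ^ (m + 2)) * (L * (real k * Im z * cmod z ^ (k - 1) / cmod w ^ (k + 1)))"
    proof (intro mult_mono T_le)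
      show "1 + cmod w ^ (m + 2) \<le> 2 * cmod w ^ (m + 2)"
        using assms one_le_power[of "cmod w" "m + 2"] by simp
    qed (use assms in auto)
    also have "\<dots> = 2 * L * Im z * real k * (cmod w ^ (m + 2) * cmod z ^ (k - 1) / cmod w ^ (k + 1))"
      by simp
    also have "cmod w ^ (m + 2) * cmod z ^ (k - 1) / cmod w ^ (k + 1) = cmod z ^ m * (r * r ^ (m - k))"
    proof -
      have 1: "cmod w ^ (m + 2) = cmod w ^ (k + 1) * (cmod w * cmod w ^ (m - k))"
        unfolding power_Suc[symmetric] power_add[symmetric]
        using that by (intro arg_cong[where f = "\<lambda>n. _ ^ n"]) simp
      have 2: "cmod z ^ m = cmod z ^ (k - 1) * (cmod z * cmod z ^ (m - k))"
        unfolding power_Suc[symmetric] power_add[symmetric]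
        using that False by (intro arg_cong[where f = "\<lambda>n. _ ^ n"]) simp
      have "cmod w \<noteq> 0"
        using assms by auto
      then show ?thesis
        unfolding r_def power_divide 1 2 using z_nz by simp
    qed
    also have "2 * L * Im z * real k * (cmod z ^ m * (r * r ^ (m - k))) \<le>
      2 * L * Im z * real m * (cmod z ^ m * ((2 * min 1 q) * 2 ^ m))"
    proof -
      have "r ^ (m - k) \<le> 2 ^ (m - k)"
        using r by (intro power_mono) auto
      also have "\<dots> \<le> 2 ^ m"
        by (intro power_increasing) auto
      finally show ?thesis
        using r that L_nonneg Im_pos q_pos by (intro mult_mono mult_nonneg_nonneg) auto
    qed
    finally show ?thesis
      by (simp add: mult_ac)
  qed
  have "(1 + cmod w ^ (m + 2)) * \<bar>\<Sum>k\<le>m. T k\<bar> \<le> (\<Sum>k\<le>m. (1 + cmod w ^ (m + 2)) * \<bar>T k\<bar>)"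
    unfolding sum_distrib_left[symmetric] by (intro mult_left_mono sum_abs) auto
  also have "\<dots> \<le> (\<Sum>k\<le>m. real m * 2 ^ (m + 2) * L * (Im z * cmod z ^ m * min 1 q))"
    using term_le by (intro sum_mono) auto
  finally show ?thesis
    by (simp add: mult_ac add.commute)
qed

text \<open>In the disc |w - z| < |z|/2 the singular factor is kept. Outside it t \<le> 2y/|z|, and
  the square turns the prefactor c L / y into 4 c L y / |z|^2, which is regular.\<close>

lemma principal_part_le:
  assumes "cmod w < 2 * cmod z"
  shows "(1 + cmod w ^ (m + 2)) * \<bar>K0\<bar> \<le> 4 * c * 3 ^ (m + 2) * L *
    (Im z * cmod z ^ m * min 1 q + cmod z ^ (m + 2) / Im z *
      (indicator (ball z (cmod z / 2)) w * min ((Im z / cmod (z - w))\<^sup>2) ((Im z / cmod (z - w)) powr \<delta>)))"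
    (is "_ \<le> ?R * (?A + ?B * (_ * ?\<phi>))")
proof (cases "cmod (z - w) < cmod z / 2")
  case True
  have "(1 + cmod w ^ (m + 2)) * \<bar>K0\<bar> \<le> (cmod z ^ (m + 2) * 3 ^ (m + 2)) * (c * L / Im z * ?\<phi>)"
  proof (intro mult_mono K0_le)
    show "1 + cmod w ^ (m + 2) \<le> cmod z ^ (m + 2) * 3 ^ (m + 2)"
      using weight_le[OF assms] by (rule order_trans) (intro mult_left_mono, auto)
  qed auto
  also have "\<dots> = c * 3 ^ (m + 2) * L * (?B * ?\<phi>)"
    by simp
  also have "\<dots> \<le> ?R * (?B * ?\<phi>)"
    using c_nonneg L_nonneg Im_pos by (intro mult_right_mono) auto
  also have "\<dots> \<le> ?R * (?A + ?B * ?\<phi>)"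
    using c_nonneg L_nonneg Im_pos q_pos by (intro mult_left_mono) auto
  finally show ?thesis
    using True by (simp add: dist_norm)
next
  case False
  have "c * L / Im z * ?\<phi> \<le> c * L / Im z * (Im z / (cmod z / 2))\<^sup>2"
  proof (intro mult_left_mono)
    have "(Im z / cmod (z - w))\<^sup>2 \<le> (Im z / (cmod z / 2))\<^sup>2"
      using False z_nz w_neq Im_pos by (intro power_mono divide_left_mono mult_pos_pos) auto
    then show "?\<phi> \<le> (Im z / (cmod z / 2))\<^sup>2"
      by (rule min.coboundedI1)
  qed (use c_nonneg L_nonneg Im_pos in auto)
  then have "\<bar>K0\<bar> \<le> c * L / Im z * (Im z / (cmod z / 2))\<^sup>2"
    using K0_le by simp
  then have "(1 + cmod w ^ (m + 2)) * \<bar>K0\<bar> \<le>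
    (cmod z ^ (m + 2) * (3 ^ (m + 2) * min 1 q)) * (c * L / Im z * (Im z / (cmod z / 2))\<^sup>2)"
    using weight_le[OF assms] q_pos by (intro mult_mono) auto
  also have "\<dots> = ?R * ?A"
    using Im_pos z_ge by (simp add: power2_eq_square power_add field_simps)
  finally show ?thesis
    using False by (simp add: dist_norm)
qed

text \<open>The three constants belong to \<open>K0\<close>, to the subtracted polynomial and to the
  tail. They are added so that one bound covers |w| \<le> 1, 1 < |w| < 2|z| and |w| \<ge>
  2|z|.\<close>

lemma kernel_le:
  "(1 + cmod w ^ (m + 2)) * \<bar>K\<bar> \<le>
    (4 * c * 3 ^ (m + 2) + (real m + 1) * real m * 2 ^ (m + 2) + 8 * (real m + 1)) * L *
    (Im z * cmod z ^ m * min 1 q + cmod z ^ (m + 2) / Im z *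
      (indicator (ball z (cmod z / 2)) w * min ((Im z / cmod (z - w))\<^sup>2) ((Im z / cmod (z - w)) powr \<delta>)))"
    (is "_ \<le> (?C1 + ?C2 + ?C3) * L * (?A + ?B)")
proof -
  have nn: "?C1 \<ge> 0" "?C2 \<ge> 0" "?C3 \<ge> 0" "?A \<ge> 0" "?B \<ge> 0"
    using c_nonneg Im_pos q_pos by auto
  have rhs: "?C1 * L * (?A + ?B) + ?C2 * L * ?A + ?C3 * L * ?A \<le> (?C1 + ?C2 + ?C3) * L * (?A + ?B)"
  proof -
    have "C1 * L * (A + B) + C2 * L * A + C3 * L * A \<le> (C1 + C2 + C3) * L * (A + B)"
      if "C2 \<ge> 0" "C3 \<ge> 0" "B \<ge> 0" for C1 C2 C3 A B
    proof -
      have "0 \<le> (C2 + C3) * L * B"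
        using that L_nonneg by simp
      then show ?thesis
        by (simp add: algebra_simps)
    qed
    from this[OF nn(2,3,5)] show ?thesis .
  qed
  show ?thesis
  proof (cases "2 * cmod z \<le> cmod w")
    case True
    have "?C1 * L * (?A + ?B) + ?C2 * L * ?A \<ge> 0"
      using nn L_nonneg by simp
    with tail_le[OF True] rhs show ?thesis
      by linarith
  next
    case False
    have p: "(1 + cmod w ^ (m + 2)) * \<bar>K0\<bar> \<le> ?C1 * L * (?A + ?B)"
      using principal_part_le False by simp
    have C3: "?C3 * L * ?A \<ge> 0" "?C2 * L * ?A \<ge> 0"
      using nn L_nonneg by auto
    show ?thesis
    proof (cases "cmod w \<le> 1")
      case True
      then have "K = K0"
        using K_eq by simp
      with p C3 rhs show ?thesis
        unfolding \<open>K = K0\<close> by linarith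
    next
      case w: False
      have "\<bar>K\<bar> \<le> \<bar>K0\<bar> + \<bar>\<Sum>k\<le>m. T k\<bar>"
        using K_eq w by simp
      then have "(1 + cmod w ^ (m + 2)) * \<bar>K\<bar> \<le>
        (1 + cmod w ^ (m + 2)) * \<bar>K0\<bar> + (1 + cmod w ^ (m + 2)) * \<bar>\<Sum>k\<le>m. T k\<bar>"
        unfolding distrib_left[symmetric] by (intro mult_left_mono) auto
      also have "(1 + cmod w ^ (m + 2)) * \<bar>\<Sum>k\<le>m. T k\<bar> \<le> ?C2 * L * ?A"
        using polynomial_part_le w False by simp
      finally show ?thesis
        using p C3 rhs by linarith
    qed
  qed
qed

lemma kernel_le_majorant:
  "ennreal \<bar>K\<bar> \<le> ennreal (L / (1 + cmod w ^ (m + 2))) *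
    (ennreal (4 * c * 3 ^ (m + 2) + (real m + 1) * real m * 2 ^ (m + 2) + 8 * (real m + 1)) * kernel_majorant m \<delta> z w)"
  (is "_ \<le> _ * (ennreal ?C * _)")
proof -
  let ?\<phi> = "min ((Im z / cmod (z - w))\<^sup>2) ((Im z / cmod (z - w)) powr \<delta>)"
  let ?ind = "indicator (ball z (cmod z / 2)) w :: real"
  let ?M = "Im z * cmod z ^ m * min 1 q + cmod z ^ (m + 2) / Im z * (?ind * ?\<phi>)"
  have C: "?C \<ge> 0"
    using c_nonneg by auto
  have M: "?M \<ge> 0"
    using Im_pos q_pos by auto
  have W: "1 + cmod w ^ (m + 2) > 0"
    by (intro add_pos_nonneg) auto
  have "ennreal ?M = ennreal (Im z * cmod z ^ m) * ennreal (min 1 q) +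
      ennreal (cmod z ^ (m + 2) / Im z) * (indicator (ball z (cmod z / 2)) w * ennreal ?\<phi>)"
  proof -
    have "ennreal ?M = ennreal (Im z * cmod z ^ m * min 1 q) + ennreal (cmod z ^ (m + 2) / Im z * (?ind * ?\<phi>))"
      using Im_pos q_pos by (intro ennreal_plus) auto
    also have "ennreal (Im z * cmod z ^ m * min 1 q) = ennreal (Im z * cmod z ^ m) * ennreal (min 1 q)"
      using Im_pos q_pos by (intro ennreal_mult) auto
    also have "ennreal (cmod z ^ (m + 2) / Im z * (?ind * ?\<phi>)) = ennreal (cmod z ^ (m + 2) / Im z) * ennreal (?ind * ?\<phi>)"
      using Im_pos by (intro ennreal_mult) auto
    also have "ennreal (?ind * ?\<phi>) = indicator (ball z (cmod z / 2)) w * ennreal ?\<phi>"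
      by (simp split: split_indicator)
    finally show ?thesis .
  qed
  also have "\<dots> \<le> kernel_majorant m \<delta> z w"
    unfolding kernel_majorant_def q_def
    by (intro add_left_mono mult_left_mono dyadic_kernel_ge Im_pos \<delta>_nonneg w_neq) auto
  finally have *: "ennreal ?M \<le> kernel_majorant m \<delta> z w" .
  have "\<bar>K\<bar> \<le> L / (1 + cmod w ^ (m + 2)) * (?C * ?M)"
  proof -
    have "\<bar>K\<bar> * (1 + cmod w ^ (m + 2)) \<le> ?C * L * ?M"
      using kernel_le by (subst mult.commute)
    then have "\<bar>K\<bar> \<le> ?C * L * ?M / (1 + cmod w ^ (m + 2))"
      by (subst pos_le_divide_eq[OF W])
    then show ?thesis
      by (simp only: times_divide_eq_left times_divide_eq_right mult_ac)
  qed
  then have "ennreal \<bar>K\<bar> \<le> ennreal (L / (1 + cmod w ^ (m + 2))) * (ennreal ?C * ennreal ?M)"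
    using L_nonneg C M W by (simp add: ennreal_mult[symmetric] ennreal_leI del: ennreal_plus)
  also have "\<dots> \<le> ennreal (L / (1 + cmod w ^ (m + 2))) * (ennreal ?C * kernel_majorant m \<delta> z w)"
    by (intro mult_left_mono *) auto
  finally show ?thesis .
qed

end

section \<open>The Poisson and Green kernels\<close>

lemma inverse_diff_sums:
  fixes z w :: complex
  assumes "cmod z < cmod w"
  shows "(\<lambda>k. z ^ k / w ^ (k + 1)) sums (1 / (w - z))"
proof -
  have w: "w \<noteq> 0"
    using assms by auto
  have "(\<lambda>k. (1 / w) * (z / w) ^ k) sums ((1 / w) * (1 / (1 - z / w)))"
    using assms w by (intro sums_mult geometric_sums) (simp add: norm_divide)
  moreover have "(1 / w) * (1 / (1 - z / w)) = 1 / (w - z)"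
    using w by (simp add: field_simps)
  ultimately show ?thesis
    by (simp add: power_divide)
qed

text \<open>The kernel is Im (1/(\<xi> - z)) / pi, whose geometric series yields the subtracted
  terms. As \<xi> is real, Im z \<le> |z - \<xi>|; hence t \<le> 1 and the minimum is t^2.\<close>

lemma poisson_kernel_modified_kernel:
  assumes z: "Im z > 0" "cmod z \<ge> 2" and \<delta>: "0 \<le> \<delta>" "\<delta> \<le> 2"
  shows "modified_kernel z (of_real \<xi>) 1 1 \<delta> (mod_poisson_kernel m z \<xi>) (poisson_kernel z \<xi>)
    (\<lambda>k. Im (z ^ k / of_real \<xi> ^ (k + 1)) / pi) m"
proof
  show "complex_of_real \<xi> \<noteq> z"
    by (rule notI) (use z in auto)
  have pi1: "1 \<le> pi"
    using pi_ge_two by linarith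
  show "\<bar>Im (z ^ k / complex_of_real \<xi> ^ (k + 1)) / pi\<bar> \<le>
      1 * (real k * Im z * cmod z ^ (k - 1) / cmod (complex_of_real \<xi>) ^ (k + 1))" for k
  proof -
    have "Im (z ^ k / complex_of_real \<xi> ^ (k + 1)) = Im (z ^ k) / \<xi> ^ (k + 1)"
      by (simp only: of_real_power[symmetric] Im_divide_of_real)
    then have "\<bar>Im (z ^ k / complex_of_real \<xi> ^ (k + 1)) / pi\<bar> = \<bar>Im (z ^ k)\<bar> / \<bar>\<xi>\<bar> ^ (k + 1) / pi"
      by (simp add: power_abs abs_mult)
    also have "\<dots> \<le> \<bar>Im (z ^ k)\<bar> / \<bar>\<xi>\<bar> ^ (k + 1) / 1"
      using pi1 by (intro divide_left_mono) auto
    also have "\<dots> \<le> real k * Im z * cmod z ^ (k - 1) / \<bar>\<xi>\<bar> ^ (k + 1)"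
      using abs_Im_power_le[of z k] z by (simp add: divide_right_mono)
    finally show ?thesis
      by simp
  qed
  have pk: "poisson_kernel z \<xi> = Im (1 / (of_real \<xi> - z)) / pi"
  proof -
    have "Im (1 / (of_real \<xi> - z)) = Im z / (cmod (of_real \<xi> - z))\<^sup>2"
      by (simp add: Im_divide cmod_power2)
    then show ?thesis
      by (simp add: poisson_kernel_def norm_minus_commute mult.commute)
  qed
  show "(\<lambda>k. Im (z ^ k / complex_of_real \<xi> ^ (k + 1)) / pi) sums poisson_kernel z \<xi>"
    if "2 * cmod z \<le> cmod (complex_of_real \<xi>)"
    unfolding pk using that z by (intro sums_divide sums_Im inverse_diff_sums) auto
  show "\<bar>poisson_kernel z \<xi>\<bar> \<le> 1 * 1 / Im z * min ((Im z / cmod (z - complex_of_real \<xi>))\<^sup>2)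
      ((Im z / cmod (z - complex_of_real \<xi>)) powr \<delta>)"
  proof -
    let ?t = "Im z / cmod (z - complex_of_real \<xi>)"
    have r: "Im z \<le> cmod (z - complex_of_real \<xi>)"
      using abs_Im_le_cmod[of "z - complex_of_real \<xi>"] by simp
    have t: "0 < ?t" "?t \<le> 1"
    proof -
      have rp: "0 < cmod (z - complex_of_real \<xi>)"
        using r z by linarith
      show "0 < ?t"
        by (rule divide_pos_pos[OF z(1) rp])
      show "?t \<le> 1"
        using r by (subst pos_divide_le_eq[OF rp]) simp
    qed
    have "?t\<^sup>2 = ?t powr 2"
      using t by simp
    also have "\<dots> \<le> ?t powr \<delta>"
      using t \<delta> by (intro powr_mono') auto
    finally have "min (?t\<^sup>2) (?t powr \<delta>) = ?t\<^sup>2"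
      by simp
    moreover have "\<bar>poisson_kernel z \<xi>\<bar> = (?t\<^sup>2 / Im z) / pi"
      using z by (simp add: poisson_kernel_def abs_mult power2_eq_square field_simps)
    moreover have "(?t\<^sup>2 / Im z) / pi \<le> (?t\<^sup>2 / Im z) / 1"
      using pi1 z by (intro divide_left_mono) auto
    ultimately show ?thesis
      by simp
  qed
  show "mod_poisson_kernel m z \<xi> = (if cmod (complex_of_real \<xi>) \<le> 1 then poisson_kernel z \<xi>
      else poisson_kernel z \<xi> - (\<Sum>k\<le>m. Im (z ^ k / complex_of_real \<xi> ^ (k + 1)) / pi))"
    by (simp add: mod_poisson_kernel_def atLeast0AtMost sum_divide_distrib)
qed (use z \<delta> in auto)

section \<open>Logarithmic series and the Green function\<close>

lemma ln_norm_one_minus_sums: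
  fixes z w :: complex
  assumes "cmod z < cmod w"
  shows "(\<lambda>k. - Re (z ^ k / (of_nat k * w ^ k))) sums (ln (cmod (z - w)) - ln (cmod w))"
proof -
  have w: "w \<noteq> 0" "cmod w > 0" "cmod (z - w) > 0"
    using assms by auto
  have "cmod (- (z / w)) < 1"
    using assms w by (simp add: norm_divide)
  \<comment> \<open>At k = 0 the term is a division by 0, hence 0, so the logarithmic series may be
    indexed from 0.\<close>
  from sums_Re[OF Ln_series'[OF this]]
  have "(\<lambda>k. Re (- ((z / w) ^ k) / of_nat k)) sums Re (ln (1 - z / w))"
    by simp
  moreover have "Re (- ((z / w) ^ k) / of_nat k) = - Re (z ^ k / (of_nat k * w ^ k))" for k
    by (simp add: power_divide mult.commute)
  moreover have "Re (ln (1 - z / w)) = ln (cmod (z - w)) - ln (cmod w)"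
  proof -
    have "1 - z / w = (w - z) / w" "(w - z) / w \<noteq> 0"
      using w by (auto simp: field_simps)
    then show ?thesis
      using w by (simp add: norm_divide ln_div norm_minus_commute)
  qed
  ultimately show ?thesis
    by simp
qed

lemma cmod_diff_cnj_power2: "(cmod (z - cnj w))\<^sup>2 = (cmod (z - w))\<^sup>2 + 4 * Im z * Im w"
  unfolding cmod_power2 by (simp add: power2_eq_square algebra_simps)

lemma ln_one_plus_le_powr:
  fixes x s :: real
  assumes "x \<ge> 0" "s > 0"
  shows "ln (1 + x) \<le> (1 + x) powr s / s"
proof -
  have "s * ln (1 + x) = ln ((1 + x) powr s)"
    using assms by (simp add: ln_powr)
  also have "\<dots> \<le> (1 + x) powr s"
    using assms by (intro order_trans[OF ln_le_minus_one]) auto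
  finally show ?thesis
    using assms by (simp add: field_simps)
qed

text \<open>ln (1 + x) \<le> x gives the bound by t^2, and also the one by t^\<delta> when t \<le>
  2, since then t^2 \<le> 4 t^\<delta>. For t > 2 the point w is so close to z that Im w / Im z lies
  between 1/2 and 3/2, and the logarithm is beaten by a small power.\<close>

lemma log_ratio_le:
  assumes z: "Im z > 0" and w: "Im w > 0" "w \<noteq> z" and \<delta>: "0 < \<delta>" "\<delta> \<le> 1"
  shows "ln (1 + 4 * Im z * Im w / (cmod (z - w))\<^sup>2) \<le>
    28 / \<delta> * Im w / Im z * min ((Im z / cmod (z - w))\<^sup>2) ((Im z / cmod (z - w)) powr \<delta>)"
proof -
  define r where "r = cmod (z - w)"
  define t where "t = Im z / r"
  have r: "r > 0"
    using w by (simp add: r_def)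
  have t: "t > 0"
    using r z by (simp add: t_def)
  have rt: "r = Im z / t"
    using z r by (simp add: t_def)
  let ?l = "ln (1 + 4 * Im z * Im w / r\<^sup>2)"
  have "?l \<le> 4 * Im z * Im w / r\<^sup>2"
    using z w by (intro ln_add_one_self_le_self) auto
  also have "\<dots> = 4 * (Im w / Im z) * t\<^sup>2"
    unfolding t_def using z by (simp add: power2_eq_square)
  finally have 1: "?l \<le> 4 * (Im w / Im z) * t\<^sup>2" .
  have ratio: "Im w / Im z > 0"
    using z w by simp
  have \<delta>28: "4 \<le> 28 / \<delta>" "16 \<le> 28 / \<delta>"
    using \<delta> by (auto simp: field_simps)
  have sq: "?l \<le> 28 / \<delta> * (Im w / Im z) * t\<^sup>2"
    using 1 by (rule order_trans) (use \<delta>28 ratio in \<open>intro mult_right_mono, auto\<close>)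
  have pw: "?l \<le> 28 / \<delta> * (Im w / Im z) * t powr \<delta>"
  proof (cases "t \<le> 2")
    case True
    have "t\<^sup>2 = t powr \<delta> * t powr (2 - \<delta>)"
      using t by (simp add: powr_add[symmetric])
    also have "\<dots> \<le> t powr \<delta> * 2 powr (2 - \<delta>)"
      using True t \<delta> by (intro mult_left_mono powr_mono2) auto
    also have "\<dots> \<le> t powr \<delta> * 2 powr 2"
      using \<delta> by (intro mult_left_mono powr_mono) auto
    finally have "t\<^sup>2 \<le> 4 * t powr \<delta>"
      by simp
    then have "4 * (Im w / Im z) * t\<^sup>2 \<le> 4 * (Im w / Im z) * (4 * t powr \<delta>)"
      using ratio by (intro mult_left_mono) auto
    also have "\<dots> = 16 * ((Im w / Im z) * t powr \<delta>)"
      by simp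
    also have "\<dots> \<le> 28 / \<delta> * ((Im w / Im z) * t powr \<delta>)"
      using \<delta>28 by (intro mult_right_mono mult_nonneg_nonneg less_imp_le[OF ratio]) auto
    finally show ?thesis
      using 1 by simp
  next
    case False
    then have rz: "r < Im z / 2"
    proof -
      have "r * 2 < r * t"
        using False r by (intro mult_strict_left_mono) auto
      then show ?thesis
        using rt t by simp
    qed
    have "\<bar>Im (z - w)\<bar> \<le> r"
      unfolding r_def by (rule abs_Im_le_cmod)
    then have Imw: "Im z / 2 \<le> Im w" "Im w \<le> 3 / 2 * Im z"
      using rz by auto
    have half: "1 / 2 \<le> Im w / Im z"
      using Imw z by (simp add: field_simps)
    have "4 * Im z * Im w / r\<^sup>2 = 4 * (Im w / Im z) * t\<^sup>2"
      unfolding t_def using z by (simp add: power2_eq_square)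
    also have "\<dots> \<le> 4 * (3 / 2) * t\<^sup>2"
      using Imw z by (intro mult_right_mono mult_left_mono) (auto simp: field_simps)
    finally have x: "4 * Im z * Im w / r\<^sup>2 \<le> 6 * t\<^sup>2"
      by simp
    have t1: "1 \<le> t\<^sup>2"
      using False by (intro one_le_power) auto
    \<comment> \<open>Exponent \<delta>/2 because x is of order t^2; then 1 + x \<le> 7 t^2 gives
      14/\<delta> t^\<delta>. The missing factor Im w / Im z is at least 1/2, which doubles 14 to
      the 28 of the statement.\<close>
    have "?l \<le> (1 + 4 * Im z * Im w / r\<^sup>2) powr (\<delta> / 2) / (\<delta> / 2)"
      using z w \<delta> by (intro ln_one_plus_le_powr) auto
    also have "\<dots> \<le> (7 * t\<^sup>2) powr (\<delta> / 2) / (\<delta> / 2)"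
      using x t1 \<delta> z w by (intro divide_right_mono powr_mono2) auto
    also have "(7 * t\<^sup>2) powr (\<delta> / 2) = 7 powr (\<delta> / 2) * t powr \<delta>"
    proof -
      have "(t\<^sup>2) powr (\<delta> / 2) = (t powr 2) powr (\<delta> / 2)"
        using t by simp
      also have "\<dots> = t powr \<delta>"
        by (simp only: powr_powr) simp
      finally show ?thesis
        using t by (simp only: powr_mult)
    qed
    also have "\<dots> / (\<delta> / 2) \<le> 7 powr 1 * t powr \<delta> / (\<delta> / 2)"
      using \<delta> by (intro divide_right_mono mult_right_mono powr_mono) auto
    also have "\<dots> = 28 / \<delta> * (1 / 2) * t powr \<delta>"
      by simp
    also have "\<dots> \<le> 28 / \<delta> * (Im w / Im z) * t powr \<delta>"
      using half \<delta> by (intro mult_right_mono mult_left_mono) auto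
    finally show ?thesis .
  qed
  have "?l \<le> 28 / \<delta> * (Im w / Im z) * min (t\<^sup>2) (t powr \<delta>)"
    using sq pw by (simp add: min_def)
  then show ?thesis
    unfolding t_def r_def by simp
qed

text \<open>The unmodified difference is -1/(4 pi) times the logarithm of |z - cnj w|^2 / |z - w|^2
  = 1 + 4 Im z Im w / |z - w|^2. The Taylor terms at w and \<open>cnj w\<close> combine into Im
  (z^k) Im (w^(-k)) / (pi k), which is where the weight Im w comes from.\<close>

lemma mod_green_modified_kernel:
  assumes z: "Im z > 0" "cmod z \<ge> 2" and w: "Im w > 0" "w \<noteq> z" and \<delta>: "0 < \<delta>" "\<delta> \<le> 1"
  shows "modified_kernel z w (Im w) (28 / \<delta>) \<delta>
    (mod_log_kernel (m + 1) z w - mod_log_kernel (m + 1) z (cnj w))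
    (log_kernel (z - w) - log_kernel (z - cnj w))
    (\<lambda>k. (Re (z ^ k / (of_nat k * cnj w ^ k)) - Re (z ^ k / (of_nat k * w ^ k))) / (2 * pi)) m"
    (is "modified_kernel _ _ _ _ _ _ ?K0 ?T _")
proof
  have pi1: "1 \<le> pi"
    using pi_ge_two by linarith
  have w0: "w \<noteq> 0"
    using w by auto
  show "\<bar>?T k\<bar> \<le> Im w * (real k * Im z * cmod z ^ (k - 1) / cmod w ^ (k + 1))" for k
  proof (cases "k = 0")
    case False
    define p where "p = (1 / w) ^ k"
    have "cnj p = (1 / cnj w) ^ k"
      by (simp add: p_def)
    then have T: "?T k = (Re (z ^ k * cnj p) - Re (z ^ k * p)) / real k / (2 * pi)"
    proof -
      have "Re (z ^ k / (of_nat k * v ^ k)) = Re (z ^ k * (1 / v) ^ k) / real k" for v :: complex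
      proof -
        have "z ^ k / (of_nat k * v ^ k) = z ^ k * (1 / v) ^ k / of_real (real k)"
          by (simp add: power_divide)
        then show ?thesis
          by (simp only: Re_divide_of_real)
      qed
      with \<open>cnj p = _\<close> show ?thesis
        by (simp add: p_def diff_divide_distrib)
    qed
    have "Re (z ^ k * cnj p) - Re (z ^ k * p) = 2 * (Im (z ^ k) * Im p)"
      by simp
    then have "\<bar>?T k\<bar> = \<bar>Im (z ^ k)\<bar> * \<bar>Im p\<bar> / real k / pi"
      unfolding T by (simp add: abs_mult)
    also have "\<dots> \<le> \<bar>Im (z ^ k)\<bar> * \<bar>Im p\<bar> / real k / 1"
      using pi1 by (intro divide_left_mono) auto
    \<comment> \<open>Each imaginary part of a k-th power costs a factor k; the denominator k of the
      logarithmic series cancels one of them.\<close>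
    also have "\<dots> \<le> (real k * Im z * cmod z ^ (k - 1)) * (real k * (Im w / (cmod w)\<^sup>2) * (1 / cmod w) ^ (k - 1)) / real k"
    proof -
      have "\<bar>Im (1 / w)\<bar> = Im w / (cmod w)\<^sup>2"
        using w by (simp add: Im_divide cmod_power2)
      then have "\<bar>Im p\<bar> \<le> real k * (Im w / (cmod w)\<^sup>2) * (1 / cmod w) ^ (k - 1)"
        using abs_Im_power_le[of "1 / w" k] by (simp add: p_def norm_divide)
      moreover have "\<bar>Im (z ^ k)\<bar> \<le> real k * Im z * cmod z ^ (k - 1)"
        using abs_Im_power_le[of z k] z by simp
      ultimately show ?thesis
        unfolding div_by_1 using z by (intro divide_right_mono mult_mono) auto
    qed
    also have "\<dots> = Im w * (real k * Im z * cmod z ^ (k - 1) / cmod w ^ (k + 1))"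
    proof -
      obtain j where "k = Suc j"
        using False not0_implies_Suc by blast
      moreover have "(a * y * A) * (a * (\<eta> / b\<^sup>2) * (1 / b) ^ j) / a = \<eta> * (a * y * A / b ^ (Suc j + 1))"
        if "a \<noteq> 0" for a y A \<eta> b :: real
        using that by (simp add: power2_eq_square power_divide)
      ultimately show ?thesis
        by simp
    qed
    finally show ?thesis .
  qed simp
  show "?T sums ?K0" if "2 * cmod z \<le> cmod w"
  proof -
    have "cmod z < cmod w" "cmod z < cmod (cnj w)"
      using that z by auto
    from sums_divide[OF sums_diff[OF ln_norm_one_minus_sums[OF this(1)] ln_norm_one_minus_sums[OF this(2)]], of "2 * pi"]
    show ?thesis
      by (simp add: log_kernel_def diff_divide_distrib)
  qed
  show "\<bar>?K0\<bar> \<le> 28 / \<delta> * Im w / Im z * min ((Im z / cmod (z - w))\<^sup>2) ((Im z / cmod (z - w)) powr \<delta>)"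
  proof -
    have r: "cmod (z - w) > 0"
      using w by simp
    have "z - cnj w \<noteq> 0"
      using z w by (auto simp: complex_eq_iff)
    then have r': "cmod (z - cnj w) > 0"
      by simp
    have x: "4 * Im z * Im w / (cmod (z - w))\<^sup>2 \<ge> 0"
      using z w by simp
    have "1 + 4 * Im z * Im w / (cmod (z - w))\<^sup>2 = (cmod (z - cnj w))\<^sup>2 / (cmod (z - w))\<^sup>2"
      unfolding cmod_diff_cnj_power2 using r by (simp add: add_divide_distrib)
    then have l: "ln (1 + 4 * Im z * Im w / (cmod (z - w))\<^sup>2) = 2 * (ln (cmod (z - cnj w)) - ln (cmod (z - w)))"
      using r r' by (simp add: ln_div ln_realpow)
    have "?K0 = - (ln (1 + 4 * Im z * Im w / (cmod (z - w))\<^sup>2) / (4 * pi))"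
      unfolding l log_kernel_def by (simp add: field_simps)
    then have "\<bar>?K0\<bar> = ln (1 + 4 * Im z * Im w / (cmod (z - w))\<^sup>2) / (4 * pi)"
      using x by simp
    also have "\<dots> \<le> ln (1 + 4 * Im z * Im w / (cmod (z - w))\<^sup>2) / 1"
      using pi1 x by (intro divide_left_mono) auto
    also have "\<dots> \<le> 28 / \<delta> * Im w / Im z * min ((Im z / cmod (z - w))\<^sup>2) ((Im z / cmod (z - w)) powr \<delta>)"
      using log_ratio_le[OF z(1) w \<delta>] by simp
    finally show ?thesis .
  qed
  show "mod_log_kernel (m + 1) z w - mod_log_kernel (m + 1) z (cnj w) =
      (if cmod w \<le> 1 then ?K0 else ?K0 - (\<Sum>k\<le>m. ?T k))"
  proof (cases "cmod w \<le> 1")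
    case True
    then show ?thesis
      by (simp add: mod_log_kernel_def)
  next
    case False
    define S where "S v = (\<Sum>k = 1..<m + 1. z ^ k / (of_nat k * v ^ k))" for v :: complex
    have E: "mod_log_kernel (m + 1) z v = log_kernel (z - v) - (Re (Ln v) - Re (S v)) / (2 * pi)"
      if "1 < cmod v" for v
      using that by (simp add: mod_log_kernel_def S_def)
    \<comment> \<open>The definition sums from 1; the extra index 0 contributes a quotient by 0,
      that is 0.\<close>
    have "{..m} = insert 0 {1..<m + 1}"
      by auto
    then have "(\<Sum>k\<le>m. ?T k) = (\<Sum>k = 1..<m + 1. ?T k)"
      by simp
    also have "\<dots> = (Re (S (cnj w)) - Re (S w)) / (2 * pi)"
      unfolding S_def by (simp only: Re_sum sum_subtractf sum_divide_distrib[symmetric])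
    finally have "(\<Sum>k\<le>m. ?T k) = (Re (S (cnj w)) - Re (S w)) / (2 * pi)" .
    \<comment> \<open>The two logarithmic corrections cancel in the difference, leaving only the
      polynomials.\<close>
    moreover have "Re (Ln (cnj w)) = Re (Ln w)"
      using w0 by simp
    ultimately show ?thesis
      using False E[of w] E[of "cnj w"] by (simp add: diff_divide_distrib)
  qed
qed (use z w \<delta> in auto)

section \<open>Decay of the potentials\<close>

lemma kernel_majorant_diag:
  assumes "Im z > 0" "\<delta> \<ge> 0"
  shows "kernel_majorant m \<delta> z z = \<infinity>"
proof -
  have "z \<noteq> 0"
    using assms by auto
  then have "ennreal (cmod z ^ (m + 2) / Im z) * \<infinity> = \<infinity>"
    using assms by (simp add: ennreal_mult_top divide_pos_pos)
  then show ?thesis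
    unfolding kernel_majorant_def using assms \<open>z \<noteq> 0\<close> by (simp add: dyadic_kernel_diag)
qed

text \<open>The factor in \<open>kernel_le_majorant\<close>; c is 1 for the Poisson kernel and
  28/\<delta> for the Green function.\<close>

definition majorant_const :: "nat \<Rightarrow> real \<Rightarrow> real" where
  "majorant_const m c = 4 * c * 3 ^ (m + 2) + (real m + 1) * real m * 2 ^ (m + 2) + 8 * (real m + 1)"

lemma majorant_const_pos: "c \<ge> 0 \<Longrightarrow> majorant_const m c > 0"
  unfolding majorant_const_def by (intro add_nonneg_pos add_nonneg_nonneg) auto

lemma mod_poisson_kernel_le_majorant:
  assumes "Im z > 0" "cmod z \<ge> 2" "0 \<le> \<delta>" "\<delta> \<le> 2"
  shows "ennreal \<bar>mod_poisson_kernel m z \<xi>\<bar> \<le> ennreal (1 / (1 + \<bar>\<xi>\<bar> ^ (m + 2))) *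
    (ennreal (majorant_const m 1) * kernel_majorant m \<delta> z (of_real \<xi>))"
  using modified_kernel.kernel_le_majorant[OF poisson_kernel_modified_kernel[OF assms]]
  by (simp add: majorant_const_def)

text \<open>On the diagonal both sides are infinite: the weight and the constant are strictly
  positive, so their product with \<infinity> is not the conventional 0.\<close>

lemma mod_green_le_majorant:
  assumes z: "Im z > 0" "cmod z \<ge> 2" and w: "Im w > 0" and \<delta>: "0 < \<delta>" "\<delta> \<le> 1"
  shows "e2ennreal \<bar>mod_green m z w\<bar> \<le> ennreal (Im w / (1 + cmod w ^ (m + 2))) *
    (ennreal (majorant_const m (28 / \<delta>)) * kernel_majorant m \<delta> z w)"
proof (cases "w = z")
  case True
  have "0 < Im z / (1 + cmod z ^ (m + 2))"
    using z by (intro divide_pos_pos add_pos_nonneg) auto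
  moreover have "majorant_const m (28 / \<delta>) > 0"
    using \<delta> by (intro majorant_const_pos) auto
  ultimately have "ennreal (Im z / (1 + cmod z ^ (m + 2))) *
      (ennreal (majorant_const m (28 / \<delta>)) * kernel_majorant m \<delta> z z) = \<infinity>"
    unfolding kernel_majorant_diag[OF z(1) less_imp_le[OF \<delta>(1)]] infinity_ennreal_def
    by (simp only: ennreal_mult_top ennreal_eq_0_iff not_le[symmetric] if_False)
  then show ?thesis
    using True by simp
next
  case False
  then show ?thesis
    using modified_kernel.kernel_le_majorant[OF mod_green_modified_kernel[OF z w False \<delta>]]
    by (simp add: mod_green_def majorant_const_def ennreal.rep_eq e2ennreal_ereal)
qed

text \<open>The measure with density g is pushed to the plane by p, which will be the inclusion of
  the real line or of the half plane. The image is finite by \<open>fin\<close>, so the planar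
  estimate applies; C is absorbed by using \<epsilon>/C.\<close>

lemma weighted_kernel_majorant_integral_small:
  fixes M :: "'a measure" and p :: "'a \<Rightarrow> complex" and g :: "'a \<Rightarrow> real"
  assumes [measurable]: "p \<in> borel_measurable M" "g \<in> borel_measurable M"
    and fin: "(\<integral>\<^sup>+x. ennreal (g x) \<partial>M) < \<infinity>" and \<alpha>: "0 < \<alpha>" "\<alpha> < 2" and "C > 0"
  shows "\<exists>S. admissible_discs (2 - \<alpha>) S \<and> (\<forall>\<epsilon>>0. \<forall>\<^sub>F z in far_outside S.
       (\<integral>\<^sup>+x. ennreal (g x) * (ennreal C * kernel_majorant m (1 - \<alpha> / 2) z (p x)) \<partial>M)
         \<le> ennreal (\<epsilon> * (Im z powr (1 - \<alpha>) * cmod z powr (real m + \<alpha>))))"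
proof -
  define N where "N = distr (density M (\<lambda>x. ennreal (g x))) borel p"
  have int: "(\<integral>\<^sup>+w. F w \<partial>N) = (\<integral>\<^sup>+x. ennreal (g x) * F (p x) \<partial>M)"
    if [measurable]: "F \<in> borel_measurable borel" for F
    unfolding N_def by (simp add: nn_integral_distr nn_integral_density)
  have "emeasure N (space N) = (\<integral>\<^sup>+w. 1 \<partial>N)"
    by simp
  also have "\<dots> = (\<integral>\<^sup>+x. ennreal (g x) \<partial>M)"
    by (subst int) simp_all
  finally have "finite_measure N"
    using fin by (intro finite_measureI) simp
  moreover have "sets N = sets borel"
    by (simp add: N_def)
  ultimately obtain S where S: "admissible_discs (2 - \<alpha>) S"
    "\<And>\<epsilon>. \<epsilon> > 0 \<Longrightarrow> \<forall>\<^sub>F z in far_outside S. (\<integral>\<^sup>+w. kernel_majorant m (1 - \<alpha> / 2) z w \<partial>N)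
         \<le> ennreal (\<epsilon> * (Im z powr (1 - \<alpha>) * cmod z powr (real m + \<alpha>)))"
    using kernel_majorant_integral_small[OF _ _ \<alpha>, of N m] by blast
  show ?thesis
  proof (intro exI[of _ S] conjI S(1) allI impI)
    fix \<epsilon> :: real assume "\<epsilon> > 0"
    then have "\<epsilon> / C > 0"
      using \<open>C > 0\<close> by simp
    from S(2)[OF this]
    show "\<forall>\<^sub>F z in far_outside S.
       (\<integral>\<^sup>+x. ennreal (g x) * (ennreal C * kernel_majorant m (1 - \<alpha> / 2) z (p x)) \<partial>M)
         \<le> ennreal (\<epsilon> * (Im z powr (1 - \<alpha>) * cmod z powr (real m + \<alpha>)))"
    proof eventually_elim
      case (elim z)
      have "(\<integral>\<^sup>+x. ennreal (g x) * (ennreal C * kernel_majorant m (1 - \<alpha> / 2) z (p x)) \<partial>M)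
        = ennreal C * (\<integral>\<^sup>+w. kernel_majorant m (1 - \<alpha> / 2) z w \<partial>N)"
        by (subst int[symmetric]) (auto simp: N_def intro!: nn_integral_cmult)
      also have "\<dots> \<le> ennreal C * ennreal (\<epsilon> / C * (Im z powr (1 - \<alpha>) * cmod z powr (real m + \<alpha>)))"
        using elim by (intro mult_left_mono) auto
      also have "\<dots> = ennreal (\<epsilon> * (Im z powr (1 - \<alpha>) * cmod z powr (real m + \<alpha>)))"
        using \<open>C > 0\<close> \<open>\<epsilon> > 0\<close> by (simp add: ennreal_mult[symmetric])
      finally show ?case .
    qed
  qed
qed

section \<open>Signed integrals controlled by integrals of absolute values\<close>

lemma abs_integral_le_of_nn_integral_le:
  fixes F :: "'a \<Rightarrow> real"
  assumes "(\<integral>\<^sup>+x. ennreal \<bar>F x\<bar> \<partial>M) \<le> ennreal B" "B \<ge> 0"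
  shows "\<bar>\<integral>x. F x \<partial>M\<bar> \<le> B"
proof (cases "integrable M F")
  case True
  have "ennreal (norm (\<integral>x. F x \<partial>M)) \<le> ennreal B"
    using order_trans[OF integral_norm_bound_ennreal[OF True]] assms(1) by simp
  then show ?thesis
    using assms(2) by simp
next
  \<comment> \<open>A non-integrable function has Bochner integral 0 by convention.\<close>
  case False
  then show ?thesis
    using assms(2) by (simp add: not_integrable_integral_eq)
qed

lemma ereal_le_abs: "x \<le> \<bar>x\<bar>" "- x \<le> \<bar>x\<bar>" for x :: ereal
  by (cases x; simp)+

text \<open>The integrals of the positive and the negative part both lie in [0, B], so their
  difference is not of the form \<infinity> - \<infinity> and has absolute value at most B.\<close>

lemma abs_ereal_integral_le:
  assumes "(\<integral>\<^sup>+x. e2ennreal \<bar>F x\<bar> \<partial>M) \<le> ennreal B" "B \<ge> 0"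
  shows "\<bar>ereal_integral M F\<bar> \<le> ereal B"
proof -
  have "(\<integral>\<^sup>+x. e2ennreal (F x) \<partial>M) \<le> (\<integral>\<^sup>+x. e2ennreal \<bar>F x\<bar> \<partial>M)"
    by (intro nn_integral_mono e2ennreal_mono ereal_le_abs)
  from order_trans[OF this assms(1)] obtain a
    where a: "0 \<le> a" "a \<le> B" "(\<integral>\<^sup>+x. e2ennreal (F x) \<partial>M) = ennreal a"
    unfolding le_ennreal_iff[OF assms(2)] by blast
  have "(\<integral>\<^sup>+x. e2ennreal (- F x) \<partial>M) \<le> (\<integral>\<^sup>+x. e2ennreal \<bar>F x\<bar> \<partial>M)"
    by (intro nn_integral_mono e2ennreal_mono ereal_le_abs)
  from order_trans[OF this assms(1)] obtain b
    where b: "0 \<le> b" "b \<le> B" "(\<integral>\<^sup>+x. e2ennreal (- F x) \<partial>M) = ennreal b"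
    unfolding le_ennreal_iff[OF assms(2)] by blast
  show ?thesis
    unfolding ereal_integral_def a(3) b(3) using a b by (simp add: enn2ereal_ennreal)
qed

lemma countable_enumeration:
  assumes "countable S"
  obtains J :: "nat set" and h where "J = UNIV \<or> (\<exists>N. J = {..<N})" "bij_betw h J S"
proof (cases "finite S")
  case True
  then obtain h where "bij_betw h {0..<card S} S"
    using ex_bij_betw_nat_finite by blast
  then show ?thesis
    using that[of "{..<card S}" h] by (simp add: atLeast0LessThan)
next
  case False
  then show ?thesis
    using that[of UNIV "from_nat_into S"] bij_betw_from_nat_into[OF assms] by simp
qed

section \<open>The two potentials and their sum\<close>

lemma mod_poisson_integral_small:
  assumes \<alpha>: "0 < \<alpha>" "\<alpha> < 2"
    and [measurable]: "f \<in> borel_measurable lebesgue"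
    and fin: "(\<integral>\<^sup>+\<xi>. ennreal (\<bar>f \<xi>\<bar> / (1 + \<bar>\<xi>\<bar> ^ (2 + m))) \<partial>lebesgue) < \<infinity>"
  shows "\<exists>S. admissible_discs (2 - \<alpha>) S \<and> (\<forall>\<epsilon>>0. \<forall>\<^sub>F z in far_outside S.
       \<bar>mod_poisson_integral m f z\<bar> \<le> \<epsilon> * (Im z powr (1 - \<alpha>) * cmod z powr (real m + \<alpha>)))"
proof -
  have id: "(\<lambda>\<xi>. \<xi>) \<in> borel_measurable lebesgue"
    by (auto intro: measurable_completion)
  note [measurable] = id
  have "complex_of_real \<in> borel_measurable lebesgue" "(\<lambda>\<xi>. \<bar>f \<xi>\<bar> / (1 + \<bar>\<xi>\<bar> ^ (2 + m))) \<in> borel_measurable lebesgue"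
    using measurable_compose[OF id borel_measurable_of_real] by measurable
  from weighted_kernel_majorant_integral_small[OF this fin \<alpha> majorant_const_pos[of 1 m], of m]
  obtain S where S: "admissible_discs (2 - \<alpha>) S"
    "\<And>\<epsilon>. \<epsilon> > 0 \<Longrightarrow> \<forall>\<^sub>F z in far_outside S.
       (\<integral>\<^sup>+\<xi>. ennreal (\<bar>f \<xi>\<bar> / (1 + \<bar>\<xi>\<bar> ^ (2 + m))) *
         (ennreal (majorant_const m 1) * kernel_majorant m (1 - \<alpha> / 2) z (of_real \<xi>)) \<partial>lebesgue)
         \<le> ennreal (\<epsilon> * (Im z powr (1 - \<alpha>) * cmod z powr (real m + \<alpha>)))"
    using zero_le_one by blast
  show ?thesis
  proof (intro exI[of _ S] conjI S(1) allI impI)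
    fix \<epsilon> :: real assume "\<epsilon> > 0"
    \<comment> \<open>The pointwise kernel bounds start at |z| = 2.\<close>
    from S(2)[OF this] eventually_far_outside_basic[of 2]
    show "\<forall>\<^sub>F z in far_outside S.
       \<bar>mod_poisson_integral m f z\<bar> \<le> \<epsilon> * (Im z powr (1 - \<alpha>) * cmod z powr (real m + \<alpha>))"
    proof eventually_elim
      case (elim z)
      then have z: "Im z > 0" "cmod z \<ge> 2"
        by auto
      show ?case
        unfolding mod_poisson_integral_def
      proof (rule abs_integral_le_of_nn_integral_le)
        let ?H = "\<lambda>\<xi>. ennreal (majorant_const m 1) * kernel_majorant m (1 - \<alpha> / 2) z (of_real \<xi>)"
        have "ennreal \<bar>mod_poisson_kernel m z \<xi> * f \<xi>\<bar> \<le> ennreal (\<bar>f \<xi>\<bar> / (1 + \<bar>\<xi>\<bar> ^ (2 + m))) * ?H \<xi>" for \<xi>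
        proof -
          have "ennreal \<bar>mod_poisson_kernel m z \<xi> * f \<xi>\<bar> = ennreal \<bar>f \<xi>\<bar> * ennreal \<bar>mod_poisson_kernel m z \<xi>\<bar>"
            by (simp add: abs_mult ennreal_mult mult.commute)
          also have "\<dots> \<le> ennreal \<bar>f \<xi>\<bar> * (ennreal (1 / (1 + \<bar>\<xi>\<bar> ^ (m + 2))) * ?H \<xi>)"
            using z \<alpha> by (intro mult_left_mono mod_poisson_kernel_le_majorant) auto
          also have "\<dots> = (ennreal \<bar>f \<xi>\<bar> * ennreal (1 / (1 + \<bar>\<xi>\<bar> ^ (m + 2)))) * ?H \<xi>"
            by (simp only: mult.assoc)
          also have "ennreal \<bar>f \<xi>\<bar> * ennreal (1 / (1 + \<bar>\<xi>\<bar> ^ (m + 2))) = ennreal (\<bar>f \<xi>\<bar> / (1 + \<bar>\<xi>\<bar> ^ (2 + m)))"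
            by (subst ennreal_mult[symmetric]) (auto simp: add.commute)
          finally show ?thesis .
        qed
        then have "(\<integral>\<^sup>+\<xi>. ennreal \<bar>mod_poisson_kernel m z \<xi> * f \<xi>\<bar> \<partial>lebesgue) \<le>
            (\<integral>\<^sup>+\<xi>. ennreal (\<bar>f \<xi>\<bar> / (1 + \<bar>\<xi>\<bar> ^ (2 + m))) * ?H \<xi> \<partial>lebesgue)"
          by (intro nn_integral_mono)
        also note elim(1)
        finally show "(\<integral>\<^sup>+\<xi>. ennreal \<bar>mod_poisson_kernel m z \<xi> * f \<xi>\<bar> \<partial>lebesgue)
            \<le> ennreal (\<epsilon> * (Im z powr (1 - \<alpha>) * cmod z powr (real m + \<alpha>)))" .
      qed (use \<open>\<epsilon> > 0\<close> in simp)
    qed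
  qed
qed

lemma mod_green_potential_small:
  assumes \<alpha>: "0 < \<alpha>" "\<alpha> < 2"
    and sets: "sets \<mu> = sets (restrict_space borel \<complex>\<^sub>+)"
    and fin: "(\<integral>\<^sup>+\<zeta>. ennreal (Im \<zeta> / (1 + cmod \<zeta> ^ (2 + m))) \<partial>\<mu>) < \<infinity>"
  shows "\<exists>S. admissible_discs (2 - \<alpha>) S \<and> (\<forall>\<epsilon>>0. \<forall>\<^sub>F z in far_outside S.
       \<bar>mod_green_potential m \<mu> z\<bar> \<le> ereal (\<epsilon> * (Im z powr (1 - \<alpha>) * cmod z powr (real m + \<alpha>))))"
proof -
  define C where "C = majorant_const m (28 / (1 - \<alpha> / 2))"
  have "C > 0"
    unfolding C_def using \<alpha> by (intro majorant_const_pos) auto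
  have space: "space \<mu> = \<complex>\<^sub>+"
    using sets_eq_imp_space_eq[OF sets] by (simp add: space_restrict_space)
  have meas: "g \<in> borel_measurable \<mu>" if "g \<in> borel_measurable borel" for g :: "complex \<Rightarrow> 'b::topological_space"
    using measurable_restrict_space1[OF that] measurable_cong_sets[OF sets refl] by blast
  have "(\<lambda>\<zeta>. \<zeta>) \<in> borel_measurable \<mu>"
    by (rule meas) measurable
  moreover have "(\<lambda>\<zeta>. Im \<zeta> / (1 + cmod \<zeta> ^ (2 + m))) \<in> borel_measurable \<mu>"
    by (rule meas) measurable
  ultimately obtain S where S: "admissible_discs (2 - \<alpha>) S"
    "\<And>\<epsilon>. \<epsilon> > 0 \<Longrightarrow> \<forall>\<^sub>F z in far_outside S.
       (\<integral>\<^sup>+\<zeta>. ennreal (Im \<zeta> / (1 + cmod \<zeta> ^ (2 + m))) * (ennreal C * kernel_majorant m (1 - \<alpha> / 2) z \<zeta>) \<partial>\<mu>)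
         \<le> ennreal (\<epsilon> * (Im z powr (1 - \<alpha>) * cmod z powr (real m + \<alpha>)))"
    using weighted_kernel_majorant_integral_small[OF _ _ fin \<alpha> \<open>C > 0\<close>, of _ m] by blast
  show ?thesis
  proof (intro exI[of _ S] conjI S(1) allI impI)
    fix \<epsilon> :: real assume "\<epsilon> > 0"
    from S(2)[OF this] eventually_far_outside_basic[of 2]
    show "\<forall>\<^sub>F z in far_outside S.
       \<bar>mod_green_potential m \<mu> z\<bar> \<le> ereal (\<epsilon> * (Im z powr (1 - \<alpha>) * cmod z powr (real m + \<alpha>)))"
    proof eventually_elim
      case (elim z)
      then have z: "Im z > 0" "cmod z \<ge> 2"
        by auto
      show ?case
        unfolding mod_green_potential_def
      proof (rule abs_ereal_integral_le)
        have "(\<integral>\<^sup>+\<zeta>. e2ennreal \<bar>mod_green m z \<zeta>\<bar> \<partial>\<mu>) \<le>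
            (\<integral>\<^sup>+\<zeta>. ennreal (Im \<zeta> / (1 + cmod \<zeta> ^ (2 + m))) * (ennreal C * kernel_majorant m (1 - \<alpha> / 2) z \<zeta>) \<partial>\<mu>)"
        proof (rule nn_integral_mono)
          fix \<zeta> assume "\<zeta> \<in> space \<mu>"
          then have "Im \<zeta> > 0"
            by (simp add: space)
          then show "e2ennreal \<bar>mod_green m z \<zeta>\<bar> \<le>
              ennreal (Im \<zeta> / (1 + cmod \<zeta> ^ (2 + m))) * (ennreal C * kernel_majorant m (1 - \<alpha> / 2) z \<zeta>)"
            using mod_green_le_majorant[of z \<zeta> "1 - \<alpha> / 2" m] z \<alpha> unfolding C_def add.commute[of 2 m] by simp
        qed
        also note elim(1)
        finally show "(\<integral>\<^sup>+\<zeta>. e2ennreal \<bar>mod_green m z \<zeta>\<bar> \<partial>\<mu>)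
            \<le> ennreal (\<epsilon> * (Im z powr (1 - \<alpha>) * cmod z powr (real m + \<alpha>)))" .
      qed (use \<open>\<epsilon> > 0\<close> in simp)
    qed
  qed
qed

theorem theorem2:
  fixes m :: nat and \<alpha> :: real and f :: "real \<Rightarrow> real" and \<mu> :: "complex measure"
    and u :: "complex \<Rightarrow> ereal"
  assumes "0 < \<alpha>" and "\<alpha> < 2"
    and "f \<in> borel_measurable lebesgue"
    and "(\<integral>\<^sup>+\<xi>. ennreal (\<bar>f \<xi>\<bar> / (1 + \<bar>\<xi>\<bar> ^ (2 + m))) \<partial>lebesgue) < \<infinity>"
    and "sets \<mu> = sets (restrict_space borel \<complex>\<^sub>+)"
    and "(\<integral>\<^sup>+\<zeta>. ennreal (Im \<zeta> / (1 + cmod \<zeta> ^ (2 + m))) \<partial>\<mu>) < \<infinity>"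
    and "\<And>z. z \<in> \<complex>\<^sub>+ \<Longrightarrow> u z = ereal (mod_poisson_integral m f z) + mod_green_potential m \<mu> z"
  shows "\<exists>(J :: nat set) (c :: nat \<Rightarrow> complex) (\<rho> :: nat \<Rightarrow> real).
           (J = UNIV \<or> (\<exists>N. J = {..<N})) \<and>
           (\<forall>j\<in>J. c j \<in> \<complex>\<^sub>+ \<and> \<rho> j > 0) \<and>
           (\<lambda>j. \<rho> j powr (2 - \<alpha>) / cmod (c j) powr (2 - \<alpha>)) summable_on J \<and>
           (\<forall>\<epsilon>>0. \<exists>R>0. \<forall>z \<in> \<complex>\<^sub>+ - (\<Union>j\<in>J. ball (c j) (\<rho> j)). cmod z \<ge> R \<longrightarrow>
              \<bar>u z\<bar> \<le> ereal (\<epsilon> * Im z powr (1 - \<alpha>) * cmod z powr (real m + \<alpha>)))"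
proof -
  let ?Q = "\<lambda>z. Im z powr (1 - \<alpha>) * cmod z powr (real m + \<alpha>)"
  obtain S1 where S1: "admissible_discs (2 - \<alpha>) S1"
    "\<And>\<epsilon>. \<epsilon> > 0 \<Longrightarrow> \<forall>\<^sub>F z in far_outside S1. \<bar>mod_poisson_integral m f z\<bar> \<le> \<epsilon> * ?Q z"
    using mod_poisson_integral_small[OF assms(1-4)] by blast
  obtain S2 where S2: "admissible_discs (2 - \<alpha>) S2"
    "\<And>\<epsilon>. \<epsilon> > 0 \<Longrightarrow> \<forall>\<^sub>F z in far_outside S2. \<bar>mod_green_potential m \<mu> z\<bar> \<le> ereal (\<epsilon> * ?Q z)"
    using mod_green_potential_small[OF assms(1,2,5,6)] by blast
  define S where "S = S1 \<union> S2"
  have adm: "admissible_discs (2 - \<alpha>) S"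
    unfolding S_def using S1(1) S2(1) by (rule admissible_discs_Un)
  then have "countable S"
    by (simp add: admissible_discs_def)
  then obtain J :: "nat set" and h where J: "J = UNIV \<or> (\<exists>N. J = {..<N})" and h: "bij_betw h J S"
    by (rule countable_enumeration)
  have pos: "Im (fst (h j)) > 0 \<and> snd (h j) > 0" if "j \<in> J" for j
    using adm bij_betwE[OF h] that unfolding admissible_discs_def by (auto simp: case_prod_unfold)
  have cover: "(\<Union>j\<in>J. ball (fst (h j)) (snd (h j))) = (\<Union>(c, r)\<in>S. ball c r)"
    unfolding bij_betw_imp_surj_on[OF h, symmetric] by (simp add: case_prod_unfold)
  have centres: "\<forall>j\<in>J. fst (h j) \<in> \<complex>\<^sub>+ \<and> snd (h j) > 0"
    using pos by simp
  \<comment> \<open>The enumeration is a bijection onto the set of discs, so unordered summability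
    carries over to the index set.\<close>
  have "(\<lambda>j. (\<lambda>(c, r). (r / cmod c) powr (2 - \<alpha>)) (h j)) summable_on J"
    unfolding summable_on_reindex_bij_betw[OF h] using adm by (simp add: admissible_discs_def)
  moreover have "(\<lambda>(c, r). (r / cmod c) powr (2 - \<alpha>)) (h j) = snd (h j) powr (2 - \<alpha>) / cmod (fst (h j)) powr (2 - \<alpha>)"
    if "j \<in> J" for j
    using pos[OF that] by (simp add: case_prod_unfold powr_divide)
  ultimately have summable: "(\<lambda>j. snd (h j) powr (2 - \<alpha>) / cmod (fst (h j)) powr (2 - \<alpha>)) summable_on J"
    by (simp cong: summable_on_cong)
  have small: "\<exists>R>0. \<forall>z \<in> \<complex>\<^sub>+ - (\<Union>j\<in>J. ball (fst (h j)) (snd (h j))). cmod z \<ge> R \<longrightarrow>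
      \<bar>u z\<bar> \<le> ereal (\<epsilon> * Im z powr (1 - \<alpha>) * cmod z powr (real m + \<alpha>))" if "\<epsilon> > 0" for \<epsilon>
  proof -
    have "\<epsilon> / 2 > 0"
      using that by simp
    \<comment> \<open>Removing the discs of the other family as well only shrinks the set of points
      at which the bound is asked for.\<close>
    have "\<forall>\<^sub>F z in far_outside S. \<bar>mod_poisson_integral m f z\<bar> \<le> \<epsilon> / 2 * ?Q z"
      by (rule filter_leD[OF far_outside_antimono S1(2)[OF \<open>\<epsilon> / 2 > 0\<close>]]) (simp add: S_def)
    moreover have "\<forall>\<^sub>F z in far_outside S. \<bar>mod_green_potential m \<mu> z\<bar> \<le> ereal (\<epsilon> / 2 * ?Q z)"
      by (rule filter_leD[OF far_outside_antimono S2(2)[OF \<open>\<epsilon> / 2 > 0\<close>]]) (simp add: S_def)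
    ultimately have "\<forall>\<^sub>F z in far_outside S. \<bar>u z\<bar> \<le> ereal (\<epsilon> * Im z powr (1 - \<alpha>) * cmod z powr (real m + \<alpha>))"
      using eventually_far_outside_basic[of 0 S]
    proof eventually_elim
      case (elim z)
      have "\<bar>u z\<bar> \<le> \<bar>ereal (mod_poisson_integral m f z)\<bar> + \<bar>mod_green_potential m \<mu> z\<bar>"
        using assms(7)[of z] elim(3) ereal_abs_add[of "ereal (mod_poisson_integral m f z)"] by simp
      also have "\<dots> \<le> ereal (\<epsilon> / 2 * ?Q z) + ereal (\<epsilon> / 2 * ?Q z)"
        using elim(1,2) by (intro add_mono) simp_all
      also have "\<dots> = ereal (\<epsilon> * Im z powr (1 - \<alpha>) * cmod z powr (real m + \<alpha>))"
        by simp
      finally show ?case .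
    qed
    then obtain R where R: "\<And>z. Im z > 0 \<Longrightarrow> cmod z \<ge> R \<Longrightarrow> z \<notin> (\<Union>(c, r)\<in>S. ball c r) \<Longrightarrow>
        \<bar>u z\<bar> \<le> ereal (\<epsilon> * Im z powr (1 - \<alpha>) * cmod z powr (real m + \<alpha>))"
      unfolding eventually_far_outside by blast
    show ?thesis
      unfolding cover
    proof (intro exI[of _ "max 1 R"] conjI ballI impI)
      fix z assume "z \<in> \<complex>\<^sub>+ - (\<Union>(c, r)\<in>S. ball c r)" "max 1 R \<le> cmod z"
      then show "\<bar>u z\<bar> \<le> ereal (\<epsilon> * Im z powr (1 - \<alpha>) * cmod z powr (real m + \<alpha>))"
        by (intro R) simp_all
    qed simp
  qed
  show ?thesis
    by (rule exI[of _ J], rule exI[of _ "\<lambda>j. fst (h j)"], rule exI[of _ "\<lambda>j. snd (h j)"])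
      (intro conjI J centres summable allI impI small)
qed

end
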